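(* Let $M$ be a smooth connected manifold without boundary with a Riemannian structure $g$ such that $(M,g)$ is geodesically complete. Let $g'$ be another Riemannian structure on $M$ which is quasi-isometric to $g$, that is, there are $C_1,C_2>0$ such that for all $x\in M$ one has $C_1g_x\le g'_x\le C_2g_x$ as norms. Then the norms $\|\cdot\|_{\mathsf{BV}}$ and $\|\cdot\|'_{\mathsf{BV}}$ corresponding to $g$ and $g'$, respectively, are equivalent.
   Context: All functions and forms are complex-valued. For a Riemannian structure on $M$ let $\mathrm{vol}$ be its volume measure, $\Omega^1_{\mathsf{C}^\infty_0}(M)$ the space of smooth compactly supported (complex) $1$-forms with $\|\alpha\|_\infty=\sup_x|\alpha(x)|_x$ ($|\cdot|_x$ the norm induced by the metric on the complexified cotangent space), $\mathrm{d}$ the exterior derivative on functions and $\mathrm{d}^\dagger$ its formal adjoint with respect to the $\mathsf{L}^2$-inner products of the metric. For $f\in\mathsf{L}^1_{\mathrm{loc}}(M)$, $$\mathrm{Var}(f)=\sup\left\{\left|\int_M\overline{f(x)}\,\mathrm{d}^\dagger\alpha(x)\,\mathrm{vol}(\mathrm{d}x)\right| : \alpha\in\Omega^1_{\mathsf{C}^\infty_0}(M),\ \|\alpha\|_\infty\le 1\right\}\in[0,\infty],$$ $\mathsf{BV}(M)=\{f\in\mathsf{L}^1(M):\mathrm{Var}(f)<\infty\}$ and $\|f\|_{\mathsf{BV}}=\|f\|_1+\mathrm{Var}(f)$, where $\|\cdot\|_1$ is the $\mathsf{L}^1$-norm. All of these depend on the Riemannian structure; a prime indicates the quantity for $g'$.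 Quasi-isometric structures have the same $\mathsf{L}^1$-spaces with equivalent norms. Equivalence of the $\mathsf{BV}$-norms means that the two $\mathsf{BV}$ spaces coincide and each norm is bounded by a constant times the other. *)

theory Defs
  imports "HOL-Analysis.Analysis"
begin

section \<open>Smooth maps between open subsets of normed spaces\<close>

text \<open>These predicates are only meaningful, and only used, for open sets.\<close>

primrec Ck_on :: "nat \<Rightarrow> 'a::real_normed_vector set \<Rightarrow> ('a \<Rightarrow> 'b::real_normed_vector) \<Rightarrow> bool" where
  "Ck_on 0 S f \<longleftrightarrow> continuous_on S f"
| "Ck_on (Suc k) S f \<longleftrightarrow>
     (\<forall>x\<in>S. f differentiable (at x)) \<and> (\<forall>v. Ck_on k S (\<lambda>x. frechet_derivative f (at x) v))"

definition smooth_on :: "'a::real_normed_vector set \<Rightarrow> ('a \<Rightarrow> 'b::real_normed_vector) \<Rightarrow> bool" where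
  "smooth_on S f \<longleftrightarrow> (\<forall>k. Ck_on k S f)"


section \<open>Smooth manifolds without boundary\<close>

text \<open>The manifold is the whole type \<open>'m\<close>, which in the theorem is Hausdorff and second
  countable. A chart is a pair of its domain and its coordinate map; the dimension is
  \<open>CARD('n)\<close>. The smooth structure is given by an atlas, which need not be maximal.\<close>

type_synonym ('m, 'n) chart = "'m set \<times> ('m \<Rightarrow> real ^ 'n)"

abbreviation cdom :: "('m, 'n) chart \<Rightarrow> 'm set" where
  "cdom c \<equiv> fst c"

abbreviation coord :: "('m, 'n) chart \<Rightarrow> 'm \<Rightarrow> real ^ 'n" where
  "coord c \<equiv> snd c"

definition crange :: "('m, 'n) chart \<Rightarrow> (real ^ 'n) set" where
  "crange c = coord c ` cdom c"

definition cinv :: "('m, 'n) chart \<Rightarrow> real ^ 'n \<Rightarrow> 'm" where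
  "cinv c = inv_into (cdom c) (coord c)"

definition is_chart :: "('m::topological_space, 'n::finite) chart \<Rightarrow> bool" where
  "is_chart c \<longleftrightarrow> open (cdom c) \<and> open (crange c) \<and>
     homeomorphism (cdom c) (crange c) (coord c) (cinv c)"

definition smooth_atlas :: "('m::topological_space, 'n::finite) chart set \<Rightarrow> bool" where
  "smooth_atlas A \<longleftrightarrow> (\<forall>c\<in>A. is_chart c) \<and> (\<Union>c\<in>A. cdom c) = UNIV \<and>
     (\<forall>c\<in>A. \<forall>c'\<in>A. smooth_on (coord c ` (cdom c \<inter> cdom c')) (coord c' \<circ> cinv c))"

definition smooth_fun ::
  "('m, 'n::finite) chart set \<Rightarrow> ('m \<Rightarrow> 'b::real_normed_vector) \<Rightarrow> bool" where
  "smooth_fun A u \<longleftrightarrow> (\<forall>c\<in>A. smooth_on (crange c) (u \<circ> cinv c))"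

definition test_fun :: "('m::topological_space, 'n::finite) chart set \<Rightarrow> ('m \<Rightarrow> complex) \<Rightarrow> bool" where
  "test_fun A u \<longleftrightarrow> smooth_fun A u \<and> compact (closure {x. u x \<noteq> 0})"


section \<open>Tangent vectors and 1-forms\<close>

text \<open>The tangent space at \<open>x\<close> is identified with \<open>real ^ 'n\<close> by means of one selected chart
  around \<open>x\<close>. In general the selected chart jumps with \<open>x\<close>, so continuity and smoothness of
  tensor fields are never expressed through this identification, but through the frames
  induced by the charts of the atlas.\<close>

definition chart_at :: "('m, 'n) chart set \<Rightarrow> 'm \<Rightarrow> ('m, 'n) chart" where
  "chart_at A x = (SOME c. c \<in> A \<and> x \<in> cdom c)"

text \<open>\<open>chart_vec A c x v\<close> is the tangent vector at \<open>x\<close> whose components with respect to the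
  coordinate frame of the chart \<open>c\<close> are \<open>v\<close>.\<close>

definition chart_vec ::
  "('m, 'n::finite) chart set \<Rightarrow> ('m, 'n) chart \<Rightarrow> 'm \<Rightarrow> real ^ 'n \<Rightarrow> real ^ 'n" where
  "chart_vec A c x = frechet_derivative (coord (chart_at A x) \<circ> cinv c) (at (coord c x))"

definition exterior_deriv ::
  "('m, 'n::finite) chart set \<Rightarrow> ('m \<Rightarrow> complex) \<Rightarrow> 'm \<Rightarrow> real ^ 'n \<Rightarrow> complex" where
  "exterior_deriv A u x = frechet_derivative (u \<circ> cinv (chart_at A x)) (at (coord (chart_at A x) x))"

text \<open>The complexified cotangent space at \<open>x\<close> consists of the real-linear maps from the tangent
  space to the complex numbers.\<close>

definition test_form ::
  "('m::topological_space, 'n::finite) chart set \<Rightarrow> ('m \<Rightarrow> real ^ 'n \<Rightarrow> complex) \<Rightarrow> bool" where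
  "test_form A \<alpha> \<longleftrightarrow> (\<forall>x. linear (\<alpha> x)) \<and>
     (\<forall>c\<in>A. \<forall>v. smooth_on (crange c) (\<lambda>y. \<alpha> (cinv c y) (chart_vec A c (cinv c y) v))) \<and>
     compact (closure {x. \<alpha> x \<noteq> (\<lambda>v. 0)})"


section \<open>Riemannian structures\<close>

type_synonym ('m, 'n) metric = "'m \<Rightarrow> real ^ 'n \<Rightarrow> real ^ 'n \<Rightarrow> real"

definition riemannian_metric ::
  "('m, 'n::finite) chart set \<Rightarrow> ('m, 'n) metric \<Rightarrow> bool" where
  "riemannian_metric A g \<longleftrightarrow>
     (\<forall>x. bilinear (g x) \<and> (\<forall>v w. g x v w = g x w v) \<and> (\<forall>v. v \<noteq> 0 \<longrightarrow> g x v v > 0)) \<and>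
     (\<forall>c\<in>A. \<forall>v w. smooth_on (crange c)
        (\<lambda>y. g (cinv c y) (chart_vec A c (cinv c y) v) (chart_vec A c (cinv c y) w)))"

definition tangent_norm :: "('m, 'n::finite) metric \<Rightarrow> 'm \<Rightarrow> real ^ 'n \<Rightarrow> real" where
  "tangent_norm g x v = sqrt (g x v v)"

definition quasi_isometric :: "('m, 'n::finite) metric \<Rightarrow> ('m, 'n) metric \<Rightarrow> bool" where
  "quasi_isometric g g' \<longleftrightarrow> (\<exists>C1 C2. C1 > 0 \<and> C2 > 0 \<and>
     (\<forall>x v. C1 * tangent_norm g x v \<le> tangent_norm g' x v \<and>
            tangent_norm g' x v \<le> C2 * tangent_norm g x v))"

text \<open>The matrix \<open>(g\<^sub>i\<^sub>j)\<close> in the chart \<open>c\<close>, at the point with coordinates \<open>y\<close>.\<close>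

definition gram ::
  "('m, 'n::finite) chart set \<Rightarrow> ('m, 'n) metric \<Rightarrow> ('m, 'n) chart \<Rightarrow> real ^ 'n \<Rightarrow> real ^ 'n ^ 'n" where
  "gram A g c y = (\<chi> i j. g (cinv c y) (chart_vec A c (cinv c y) (axis i 1))
                                       (chart_vec A c (cinv c y) (axis j 1)))"

text \<open>The Hermitian extension of the dual inner product to the complexified cotangent space at
  \<open>x\<close>, antilinear in the first argument: in terms of any basis \<open>e\<^sub>i\<close> of the tangent space it is
  the sum over \<open>g\<^sup>i\<^sup>j cnj (a e\<^sub>i) (b e\<^sub>j)\<close>.\<close>

definition cotangent_inner ::
  "('m, 'n::finite) metric \<Rightarrow> 'm \<Rightarrow> (real ^ 'n \<Rightarrow> complex) \<Rightarrow> (real ^ 'n \<Rightarrow> complex) \<Rightarrow> complex" where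
  "cotangent_inner g x a b =
     (\<Sum>i\<in>UNIV. \<Sum>j\<in>UNIV.
        complex_of_real (matrix_inv (\<chi> k l. g x (axis k 1) (axis l 1)) $ i $ j)
        * cnj (a (axis i 1)) * b (axis j 1))"

definition cotangent_norm :: "('m, 'n::finite) metric \<Rightarrow> 'm \<Rightarrow> (real ^ 'n \<Rightarrow> complex) \<Rightarrow> real" where
  "cotangent_norm g x a = sqrt (Re (cotangent_inner g x a a))"

definition form_sup_norm :: "('m, 'n::finite) metric \<Rightarrow> ('m \<Rightarrow> real ^ 'n \<Rightarrow> complex) \<Rightarrow> ennreal" where
  "form_sup_norm g \<alpha> = (SUP x. ennreal (cotangent_norm g x (\<alpha> x)))"

text \<open>The Riemannian volume measure is the unique Borel measure which in every chart has the
  Lebesgue density \<open>sqrt (det (g\<^sub>i\<^sub>j))\<close>.\<close>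

definition riemannian_vol ::
  "('m::topological_space, 'n::finite) chart set \<Rightarrow> ('m, 'n) metric \<Rightarrow> 'm measure" where
  "riemannian_vol A g = (THE \<mu>. sets \<mu> = sets borel \<and>
     (\<forall>c\<in>A. \<forall>S\<in>sets borel. S \<subseteq> cdom c \<longrightarrow>
        emeasure \<mu> S = (\<integral>\<^sup>+y\<in>coord c ` S. ennreal (sqrt (det (gram A g c y))) \<partial>lborel)))"


section \<open>Geodesic completeness\<close>

definition christoffel ::
  "('m, 'n::finite) chart set \<Rightarrow> ('m, 'n) metric \<Rightarrow> ('m, 'n) chart \<Rightarrow> real ^ 'n \<Rightarrow> 'n \<Rightarrow> 'n \<Rightarrow> 'n \<Rightarrow> real" where
  "christoffel A g c y k i j =
     (let D = (\<lambda>r p q. frechet_derivative (\<lambda>z. gram A g c z $ p $ q) (at y) (axis r 1))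
      in (\<Sum>l\<in>UNIV. matrix_inv (gram A g c y) $ k $ l * (D i j l + D j i l - D l i j)) / 2)"

text \<open>\<open>\<gamma>\<close> is a geodesic of the Levi-Civita connection on the open interval \<open>I\<close>
  (values of \<open>\<gamma>\<close> outside \<open>I\<close> are irrelevant).\<close>

definition geodesic_on ::
  "('m::topological_space, 'n::finite) chart set \<Rightarrow> ('m, 'n) metric \<Rightarrow> real set \<Rightarrow> (real \<Rightarrow> 'm) \<Rightarrow> bool" where
  "geodesic_on A g I \<gamma> \<longleftrightarrow> continuous_on I \<gamma> \<and>
     (\<forall>c\<in>A. let y = coord c \<circ> \<gamma>;
                y' = (\<lambda>t. vector_derivative y (at t));
                y'' = (\<lambda>t. vector_derivative y' (at t));
                J = {t\<in>I. \<gamma> t \<in> cdom c}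
            in smooth_on J y \<and>
               (\<forall>t\<in>J. \<forall>k. y'' t $ k +
                  (\<Sum>i\<in>UNIV. \<Sum>j\<in>UNIV. christoffel A g c (y t) k i j * y' t $ i * y' t $ j) = 0))"

definition geodesically_complete ::
  "('m::topological_space, 'n::finite) chart set \<Rightarrow> ('m, 'n) metric \<Rightarrow> bool" where
  "geodesically_complete A g \<longleftrightarrow>
     (\<forall>I \<gamma>. open I \<and> is_interval I \<and> I \<noteq> {} \<and> geodesic_on A g I \<gamma> \<longrightarrow>
        (\<exists>\<delta>. geodesic_on A g UNIV \<delta> \<and> (\<forall>t\<in>I. \<delta> t = \<gamma> t)))"


section \<open>Functions of bounded variation\<close>

text \<open>\<open>is_codiff A g \<alpha> h\<close> says that \<open>h\<close> is the function \<open>d\<^sup>\<dagger> \<alpha>\<close>, where \<open>d\<^sup>\<dagger>\<close> is the formal adjoint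
  of \<open>d\<close>. For every test form \<open>\<alpha>\<close> there is exactly one such \<open>h\<close>.\<close>

definition is_codiff ::
  "('m::topological_space, 'n::finite) chart set \<Rightarrow> ('m, 'n) metric \<Rightarrow>
     ('m \<Rightarrow> real ^ 'n \<Rightarrow> complex) \<Rightarrow> ('m \<Rightarrow> complex) \<Rightarrow> bool" where
  "is_codiff A g \<alpha> h \<longleftrightarrow> smooth_fun A h \<and>
     (\<forall>\<phi>. test_fun A \<phi> \<longrightarrow>
        (\<integral>x. cnj (\<phi> x) * h x \<partial>riemannian_vol A g) =
        (\<integral>x. cotangent_inner g x (exterior_deriv A \<phi> x) (\<alpha> x) \<partial>riemannian_vol A g))"

text \<open>For locally integrable \<open>f\<close> this is the variation; for other \<open>f\<close> it has no meaning.\<close>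

definition variation ::
  "('m::topological_space, 'n::finite) chart set \<Rightarrow> ('m, 'n) metric \<Rightarrow> ('m \<Rightarrow> complex) \<Rightarrow> ennreal" where
  "variation A g f =
     Sup {ennreal (cmod (\<integral>x. cnj (f x) * h x \<partial>riemannian_vol A g)) | \<alpha> h.
            test_form A \<alpha> \<and> form_sup_norm g \<alpha> \<le> 1 \<and> is_codiff A g \<alpha> h}"

text \<open>Integrable functions are not identified when they agree almost everywhere.\<close>

definition BV ::
  "('m::topological_space, 'n::finite) chart set \<Rightarrow> ('m, 'n) metric \<Rightarrow> ('m \<Rightarrow> complex) set" where
  "BV A g = {f. integrable (riemannian_vol A g) f \<and> variation A g f < \<infinity>}"

definition BV_norm ::
  "('m::topological_space, 'n::finite) chart set \<Rightarrow> ('m, 'n) metric \<Rightarrow> ('m \<Rightarrow> complex) \<Rightarrow> ennreal" where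
  "BV_norm A g f = (\<integral>\<^sup>+x. ennreal (cmod (f x)) \<partial>riemannian_vol A g) + variation A g f"

definition BV_norms_equivalent ::
  "('m::topological_space, 'n::finite) chart set \<Rightarrow> ('m, 'n) metric \<Rightarrow> ('m, 'n) metric \<Rightarrow> bool" where
  "BV_norms_equivalent A g g' \<longleftrightarrow> BV A g = BV A g' \<and>
     (\<exists>C D::real. C > 0 \<and> D > 0 \<and>
        (\<forall>f\<in>BV A g. BV_norm A g' f \<le> ennreal C * BV_norm A g f \<and>
                     BV_norm A g f \<le> ennreal D * BV_norm A g' f))"

end

(*
The two structures are compared test form by test form. Let r be the density of the volume of g'
with respect to that of g. A test form alpha is transferred to the test form beta with
g(a, beta) = r g'(a, alpha) for all covectors a. Integrating against d phi shows that the
codifferentials satisfy d* beta = r d*' alpha, so f has the same pairing with d* beta in the volume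
of g as with d*' alpha in that of g'. Quasi-isometry bounds r and hence the norm of beta by a
constant times that of alpha, uniformly on M.
*)

theory Submission
  imports Defs
begin

subsection \<open>Smooth functions\<close>

text \<open>The variation is a supremum over pairs of a form and a codifferential, so an
  injection-free transfer of admissible pairs already gives an inequality. Multiplying the
  codifferential by r, instead of differentiating a product, keeps the derivatives of r out of every
  estimate: only its size counts. In a basis orthonormal for g the matrix of g' has entries at most
  C2^2, so the Leibniz formula bounds r^2 by n! C2^(2n); transferring covectors costs a further
  factor 1/C1. Quasi-isometry is symmetric, so one inequality suffices. Two obstacles shape the
  proof. The volume is a definite description: a measure with the prescribed chart densities has to
  be built from countably many Borel pieces lying in charts, and the change of variables formula has
  to show that the result does not depend on the charts. Moreover, the chart that identifies the
  tangent space with coordinate space jumps from point to point, so smoothness of beta is visible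
  only in chart frames, where beta arises by solving a linear system with the matrix of g'.\<close>

lemma Ck_on_cong:
  assumes "open S" "\<And>x. x \<in> S \<Longrightarrow> f x = g x" "Ck_on k S f"
  shows "Ck_on k S g"
  using assms(2,3)
proof (induction k arbitrary: f g)
  case 0
  then show ?case by (simp cong: continuous_on_cong)
next
  case (Suc k)
  have d: "(g has_derivative frechet_derivative f (at x)) (at x)" if "x \<in> S" for x
    using Suc.prems that assms(1)
    by (metis Ck_on.simps(2) frechet_derivative_works has_derivative_transform_within_open)
  then have "frechet_derivative f (at x) = frechet_derivative g (at x)" if "x \<in> S" for x
    using that by (metis frechet_derivative_at)
  then show ?case
    using Suc.prems d Suc.IH[of "\<lambda>x. frechet_derivative f (at x) v" "\<lambda>x. frechet_derivative g (at x) v" for v]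
    by (auto simp: differentiable_def)
qed

text \<open>\<open>frechet_derivative\<close> is a choice operator; uniqueness of derivatives on an
  open set lets any explicit formula take its place. The closure rules below rest on this.\<close>

lemma Ck_on_SucI:
  assumes "open S"
    and "\<And>x. x \<in> S \<Longrightarrow> (f has_derivative f' x) (at x)"
    and "\<And>v. Ck_on k S (\<lambda>x. f' x v)"
  shows "Ck_on (Suc k) S f"
  unfolding Ck_on.simps
proof (intro conjI allI ballI)
  show "f differentiable at x" if "x \<in> S" for x
    using assms(2)[OF that] by (auto simp: differentiable_def)
  show "Ck_on k S (\<lambda>x. frechet_derivative f (at x) v)" for v
    using assms(2) by (intro Ck_on_cong[OF assms(1) _ assms(3)[of v]]) (metis frechet_derivative_at)
qed

lemma Ck_on_has_derivative:
  "Ck_on (Suc k) S f \<Longrightarrow> x \<in> S \<Longrightarrow> (f has_derivative frechet_derivative f (at x)) (at x)"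
  by (simp add: frechet_derivative_works)

lemma Ck_on_SucD: "Ck_on (Suc k) S f \<Longrightarrow> Ck_on k S f"
proof (induction k arbitrary: f)
  case 0
  then show ?case
    by (auto intro!: continuous_at_imp_continuous_on differentiable_imp_continuous_within)
next
  case (Suc k)
  then show ?case by simp
qed

lemma Ck_on_const: "open S \<Longrightarrow> Ck_on k S (\<lambda>x. c)"
  by (induction k arbitrary: c) (auto intro!: Ck_on_SucI[of _ _ "\<lambda>x v. 0"])

lemma Ck_on_add:
  assumes "open S"
  shows "Ck_on k S f \<Longrightarrow> Ck_on k S g \<Longrightarrow> Ck_on k S (\<lambda>x. f x + g x)"
proof (induction k arbitrary: f g)
  case 0
  then show ?case by (simp add: continuous_on_add)
next
  case (Suc k)
  note d = Ck_on_has_derivative[OF Suc.prems(1)] Ck_on_has_derivative[OF Suc.prems(2)]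
  show ?case
    by (rule Ck_on_SucI[OF assms has_derivative_add[OF d]]) (use Suc in auto)
qed

text \<open>The product rule yields two products of a derivative with an undifferentiated factor.
  The latter is lowered by one order, so that the induction hypothesis applies to both.\<close>

lemma (in bounded_bilinear) Ck_on:
  assumes "open S"
  shows "Ck_on k S f \<Longrightarrow> Ck_on k S g \<Longrightarrow> Ck_on k S (\<lambda>x. prod (f x) (g x))"
proof (induction k arbitrary: f g)
  case 0
  then show ?case by (simp add: continuous_on)
next
  case (Suc k)
  note d = Ck_on_has_derivative[OF Suc.prems(1)] Ck_on_has_derivative[OF Suc.prems(2)]
  show ?case
    by (rule Ck_on_SucI[OF assms FDERIV[OF d]])
      (use Suc.prems Suc.prems[THEN Ck_on_SucD] in \<open>auto intro!: Ck_on_add Suc.IH assms\<close>)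
qed

lemma smooth_on_cong:
  "open S \<Longrightarrow> (\<And>x. x \<in> S \<Longrightarrow> f x = g x) \<Longrightarrow> smooth_on S f \<Longrightarrow> smooth_on S g"
  unfolding smooth_on_def using Ck_on_cong by blast

lemma smooth_on_const: "open S \<Longrightarrow> smooth_on S (\<lambda>x. c)"
  by (simp add: smooth_on_def Ck_on_const)

lemma smooth_on_add:
  "open S \<Longrightarrow> smooth_on S f \<Longrightarrow> smooth_on S g \<Longrightarrow> smooth_on S (\<lambda>x. f x + g x)"
  by (simp add: smooth_on_def Ck_on_add)

lemma smooth_on_mult:
  fixes f g :: "_ \<Rightarrow> 'b::real_normed_algebra"
  shows "open S \<Longrightarrow> smooth_on S f \<Longrightarrow> smooth_on S g \<Longrightarrow> smooth_on S (\<lambda>x. f x * g x)"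
  by (simp add: smooth_on_def bounded_bilinear.Ck_on[OF bounded_bilinear_mult])

lemma smooth_on_scaleR:
  "open S \<Longrightarrow> smooth_on S f \<Longrightarrow> smooth_on S g \<Longrightarrow> smooth_on S (\<lambda>x. f x *\<^sub>R g x)"
  by (simp add: smooth_on_def bounded_bilinear.Ck_on[OF bounded_bilinear_scaleR])

lemma smooth_on_sum:
  "open S \<Longrightarrow> (\<And>i. i \<in> I \<Longrightarrow> smooth_on S (f i)) \<Longrightarrow> smooth_on S (\<lambda>x. \<Sum>i\<in>I. f i x)"
  by (induction I rule: infinite_finite_induct) (auto intro: smooth_on_const smooth_on_add)

lemma smooth_on_prod:
  fixes f :: "'i \<Rightarrow> _ \<Rightarrow> 'b::real_normed_field"
  shows "open S \<Longrightarrow> (\<And>i. i \<in> I \<Longrightarrow> smooth_on S (f i)) \<Longrightarrow> smooth_on S (\<lambda>x. \<Prod>i\<in>I. f i x)"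
  by (induction I rule: infinite_finite_induct) (auto intro: smooth_on_const smooth_on_mult)

lemma smooth_on_continuous_on: "smooth_on S f \<Longrightarrow> continuous_on S f"
  unfolding smooth_on_def using Ck_on.simps(1) by blast

lemma smooth_on_has_derivative:
  "smooth_on S f \<Longrightarrow> x \<in> S \<Longrightarrow> (f has_derivative frechet_derivative f (at x)) (at x)"
  unfolding smooth_on_def using Ck_on_has_derivative by blast

text \<open>Differentiation lowers the exponent by one, so the induction has to range over all real
  exponents. The exponents \<open>1 / 2\<close> and \<open>- 1\<close> then give square roots and
  reciprocals at once.\<close>

lemma smooth_on_powr:
  fixes f :: "_ \<Rightarrow> real"
  assumes "open S" "smooth_on S f" "\<And>x. x \<in> S \<Longrightarrow> f x > 0"
  shows "smooth_on S (\<lambda>x. f x powr r)"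
  unfolding smooth_on_def
proof
  fix k
  show "Ck_on k S (\<lambda>x. f x powr r)"
  proof (induction k arbitrary: r)
    case 0
    show ?case
      using smooth_on_continuous_on[OF assms(2)] assms(3)
      by (auto intro!: continuous_on_powr continuous_on_const) (metis less_irrefl)
  next
    case (Suc k)
    have d: "((\<lambda>x. f x powr r) has_derivative
        (\<lambda>v. r * f x powr (r - 1) * frechet_derivative f (at x) v)) (at x)" if "x \<in> S" for x
    proof -
      have "((\<lambda>t. t powr r) has_derivative (*) (r * f x powr (r - 1))) (at (f x))"
        using has_real_derivative_powr[OF assms(3)[OF that], of r]
        by (simp add: has_field_derivative_def)
      from has_derivative_compose[OF smooth_on_has_derivative[OF assms(2) that] this]
      show ?thesis by simp
    qed
    have "Ck_on k S (\<lambda>x. frechet_derivative f (at x) v)" for v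
      using assms(2) unfolding smooth_on_def by (metis Ck_on.simps(2))
    then show ?case
      by (intro Ck_on_SucI[OF assms(1) d] bounded_bilinear.Ck_on[OF bounded_bilinear_mult]
          Ck_on_const Suc.IH assms(1))
  qed
qed

section \<open>Determinants and linear systems with smooth coefficients\<close>

lemma smooth_on_det:
  fixes M :: "_ \<Rightarrow> real ^ 'n ^ 'n"
  assumes "open S" "\<And>i j. smooth_on S (\<lambda>x. M x $ i $ j)"
  shows "smooth_on S (\<lambda>x. det (M x))"
  unfolding det_def
  by (intro smooth_on_sum smooth_on_mult smooth_on_const smooth_on_prod assms)

lemma matrix_inv_right_left:
  fixes M :: "real ^ 'n ^ 'n"
  assumes "det M \<noteq> 0"
  shows "M ** matrix_inv M = mat 1" "matrix_inv M ** M = mat 1"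
  using someI_ex[of "\<lambda>N. M ** N = mat 1 \<and> N ** M = mat 1"] assms
  by (auto simp: matrix_inv_def invertible_det_nz[symmetric] invertible_def)

text \<open>By Cramer's rule each component of the solution is a quotient of determinants, where
  \<open>?N\<close> has column \<open>i\<close> replaced by \<open>b\<close>. This avoids
  differentiating the matrix inverse, which is defined by choice.\<close>

lemma smooth_on_solve:
  fixes M :: "_ \<Rightarrow> real ^ 'n ^ 'n" and b :: "_ \<Rightarrow> real ^ 'n"
  assumes "open S" "\<And>i j. smooth_on S (\<lambda>x. M x $ i $ j)" "\<And>i. smooth_on S (\<lambda>x. b x $ i)"
    and "\<And>x. x \<in> S \<Longrightarrow> det (M x) > 0"
  shows "smooth_on S (\<lambda>x. (matrix_inv (M x) *v b x) $ i)"
proof -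
  let ?N = "\<lambda>x. \<chi> k j. if j = i then b x $ k else M x $ k $ j"
  have "smooth_on S (\<lambda>x. det (?N x) * det (M x) powr (- 1))"
    using assms(2,3) by (intro smooth_on_mult smooth_on_det smooth_on_powr assms) (simp, case_tac "j = i", auto)
  moreover have "det (?N x) * det (M x) powr (- 1) = (matrix_inv (M x) *v b x) $ i" if "x \<in> S" for x
  proof -
    have nz: "det (M x) > 0" using assms(4) that .
    then have "M x *v (matrix_inv (M x) *v b x) = b x"
      by (simp add: matrix_vector_mul_assoc matrix_inv_right_left)
    then have "(matrix_inv (M x) *v b x) $ i = det (?N x) / det (M x)"
      using nz by (subst (asm) cramer) auto
    then show ?thesis using nz by (simp add: powr_minus divide_inverse)
  qed
  ultimately show ?thesis by (rule smooth_on_cong[OF assms(1), rotated])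
qed

subsection \<open>Inner products on coordinate space\<close>

definition inner_form :: "(real ^ 'n \<Rightarrow> real ^ 'n \<Rightarrow> real) \<Rightarrow> bool" where
  "inner_form b \<longleftrightarrow> bilinear b \<and> (\<forall>v w. b v w = b w v) \<and> (\<forall>v. v \<noteq> 0 \<longrightarrow> b v v > 0)"

definition form_matrix :: "(real ^ 'n \<Rightarrow> real ^ 'n \<Rightarrow> real) \<Rightarrow> real ^ 'n ^ 'n" where
  "form_matrix b = (\<chi> i j. b (axis i 1) (axis j 1))"

lemma inner_form_nonneg: "inner_form b \<Longrightarrow> b v v \<ge> 0"
  unfolding inner_form_def by (metis bilinear_lzero less_eq_real_def)

lemma linear_sum_axis:
  fixes f :: "real ^ 'n \<Rightarrow> 'b::real_vector"
  assumes "linear f"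
  shows "f v = (\<Sum>i\<in>UNIV. v $ i *\<^sub>R f (axis i 1))"
proof -
  have "f v = f (\<Sum>i\<in>UNIV. v $ i *\<^sub>R axis i 1)"
    using basis_expansion[of v] by (simp add: scalar_mult_eq_scaleR)
  also have "\<dots> = (\<Sum>i\<in>UNIV. v $ i *\<^sub>R f (axis i 1))"
    by (simp add: linear_sum[OF assms] linear_scale[OF assms])
  finally show ?thesis .
qed

lemma form_matrix_mult:
  assumes "bilinear b"
  shows "(form_matrix b *v w) $ i = b (axis i 1) w"
  using linear_sum_axis[of "b (axis i 1)" w] assms
  by (simp add: bilinear_def form_matrix_def matrix_vector_mult_def mult.commute)

lemma form_matrix_inner:
  assumes "bilinear b"
  shows "b v w = v \<bullet> (form_matrix b *v w)"
  using linear_sum_axis[of "\<lambda>v. b v w" v] assms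
  by (simp add: inner_vec_def form_matrix_mult bilinear_def)

lemma bilinear_pullback:
  assumes "bilinear b" "linear P"
  shows "bilinear (\<lambda>v w. b (P v) (P w))"
  using assms linear_compose[OF assms(2)] unfolding bilinear_def o_def by blast

lemma form_matrix_pullback:
  fixes b :: "real ^ 'n \<Rightarrow> real ^ 'n \<Rightarrow> real"
  assumes "bilinear b" "linear P"
  shows "form_matrix (\<lambda>v w. b (P v) (P w)) = transpose (matrix P) ** form_matrix b ** matrix P"
    (is "?l = ?r")
proof -
  have "v \<bullet> (?l *v w) = v \<bullet> (?r *v w)" for v w
  proof -
    have "v \<bullet> (?l *v w) = (matrix P *v v) \<bullet> (form_matrix b *v (matrix P *v w))"
      using form_matrix_inner[OF bilinear_pullback[OF assms], of v w]
        form_matrix_inner[OF assms(1), of "P v" "P w"] assms(2)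
      by (simp add: matrix_vector_mul(2)[THEN fun_cong])
    also have "\<dots> = v \<bullet> (transpose (matrix P) *v (form_matrix b *v (matrix P *v w)))"
      by (simp only: dot_lmul_matrix[symmetric] vector_transpose_matrix)
    also have "\<dots> = v \<bullet> (?r *v w)"
      by (simp only: matrix_vector_mul_assoc matrix_mul_assoc)
    finally show ?thesis .
  qed
  then have "?l *v w = ?r *v w" for w
    using vector_eq_ldot by blast
  then show ?thesis by (simp add: matrix_eq)
qed

text \<open>The square of the Jacobian is what makes root determinants transform like densities, and
  what cancels in the quotient for two metrics.\<close>

lemma det_form_matrix_pullback:
  assumes "bilinear b" "linear P"
  shows "det (form_matrix (\<lambda>v w. b (P v) (P w))) = (det (matrix P))\<^sup>2 * det (form_matrix b)"
  by (simp add: form_matrix_pullback[OF assms] det_mul power2_eq_square)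

lemma inner_form_pullback:
  assumes "inner_form b" "linear P" "inj P"
  shows "inner_form (\<lambda>v w. b (P v) (P w))"
  using assms linear_injective_0[OF assms(2)] bilinear_pullback unfolding inner_form_def by blast

lemma inner_form_orthonormal_family:
  fixes b :: "real ^ 'n \<Rightarrow> real ^ 'n \<Rightarrow> real"
  assumes "inner_form b" "k \<le> CARD('n)"
  shows "\<exists>S. finite S \<and> card S = k \<and> (\<forall>v\<in>S. \<forall>w\<in>S. b v w = (if v = w then 1 else 0))"
  using assms(2)
proof (induction k)
  case 0
  show ?case by (auto intro: exI[of _ "{}"])
next
  case (Suc k)
  have bil: "bilinear b" and sym: "b v w = b w v" for v w
    using assms(1) by (auto simp: inner_form_def)
  from Suc obtain S where S: "finite S" "card S = k"
    "\<And>v w. v \<in> S \<Longrightarrow> w \<in> S \<Longrightarrow> b v w = (if v = w then 1 else 0)" by auto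
  have "dim S < DIM(real ^ 'n)"
    using dim_le_card'[OF S(1)] S(2) Suc.prems by simp
  then have "span S \<noteq> UNIV" using dim_eq_full by (metis less_irrefl)
  then obtain u where u: "u \<notin> span S" by auto
  \<comment> \<open>Gram-Schmidt: \<open>p\<close> is the part of \<open>u\<close> orthogonal to
    \<open>S\<close>. It is nonzero because \<open>u\<close> lies outside the span, which
    \<open>k\<close> vectors cannot fill while \<open>k\<close> is below the dimension.\<close>
  define p where "p = u - (\<Sum>s\<in>S. b s u *\<^sub>R s)"
  have "b s u *\<^sub>R s \<in> span S" if "s \<in> S" for s
    using that by (simp add: span_base span_scale)
  then have "(\<Sum>s\<in>S. b s u *\<^sub>R s) \<in> span S" by (rule span_sum)
  then have "u \<noteq> (\<Sum>s\<in>S. b s u *\<^sub>R s)" using u by metis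
  then have "p \<noteq> 0" by (simp only: p_def right_minus_eq not_False_eq_True)
  then have pos: "b p p > 0" using assms(1) by (auto simp: inner_form_def)
  have orth: "b s p = 0" if "s \<in> S" for s
  proof -
    interpret linear "b s" using bil by (simp add: bilinear_def)
    have "b s p = b s u - (\<Sum>t\<in>S. b t u * b s t)" by (simp add: p_def diff sum scale)
    also have "(\<Sum>t\<in>S. b t u * b s t) = (\<Sum>t\<in>S. if t = s then b s u else 0)"
      using that by (intro sum.cong) (auto simp: S(3))
    finally show ?thesis using S(1) that by simp
  qed
  define q where "q = (1 / sqrt (b p p)) *\<^sub>R p"
  have q: "b q q = 1" "\<And>s. s \<in> S \<Longrightarrow> b s q = 0"
    using pos orth by (auto simp: q_def bilinear_lmul[OF bil] bilinear_rmul[OF bil])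
  then have "q \<notin> S" by fastforce
  moreover have "b v w = (if v = w then 1 else 0)" if "v \<in> insert q S" "w \<in> insert q S" for v w
  proof (cases "v = w")
    case True
    then show ?thesis using that S(3) q(1) by auto
  next
    case False
    then show ?thesis using that S(3)[of v w] q(2)[of v] q(2)[of w] sym[of v w] by auto
  qed
  ultimately show ?case
    using S(1,2) by (intro exI[of _ "insert q S"]) simp
qed

text \<open>Packing the basis into a linear map, as the columns of a matrix, makes passing to it a
  pullback, so that the determinant rule for pullbacks applies.\<close>

lemma inner_form_orthonormal_basis:
  fixes b :: "real ^ 'n \<Rightarrow> real ^ 'n \<Rightarrow> real"
  assumes "inner_form b"
  shows "\<exists>B :: real ^ 'n \<Rightarrow> real ^ 'n. linear B \<and>
    (\<forall>i j. b (B (axis i 1)) (B (axis j 1)) = (if i = j then 1 else 0))"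
proof -
  obtain S where S: "finite S" "card S = CARD('n)"
    "\<And>v w. v \<in> S \<Longrightarrow> w \<in> S \<Longrightarrow> b v w = (if v = w then 1 else 0)"
    using inner_form_orthonormal_family[OF assms order_refl] by blast
  then obtain e where e: "bij_betw e (UNIV :: 'n set) S"
    by (metis finite_class.finite_UNIV finite_same_card_bij)
  define M :: "real ^ 'n ^ 'n" where "M = (\<chi> i j. e j $ i)"
  have "M *v axis j 1 = e j" for j
    by (simp add: M_def matrix_vector_mult_basis column_def)
  moreover have "b (e i) (e j) = (if i = j then 1 else 0)" for i j
    using S(3)[of "e i" "e j"] e unfolding bij_betw_def inj_on_def by auto
  ultimately show ?thesis by (intro exI[of _ "(*v) M"]) auto
qed

lemma det_form_matrix_orthonormal:
  assumes "inner_form b" "linear B"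
    "\<And>i j. b (B (axis i 1)) (B (axis j 1)) = (if i = j then 1 else 0)"
  shows "(det (matrix B))\<^sup>2 * det (form_matrix b) = 1"
proof -
  have "form_matrix (\<lambda>v w. b (B v) (B w)) = mat 1"
    by (simp add: form_matrix_def mat_def assms(3))
  then show ?thesis
    using det_form_matrix_pullback[of b B] assms(1,2) by (simp add: inner_form_def)
qed

lemma det_form_matrix_pos:
  fixes b :: "real ^ 'n \<Rightarrow> real ^ 'n \<Rightarrow> real"
  assumes "inner_form b"
  shows "det (form_matrix b) > 0"
proof -
  obtain B :: "real ^ 'n \<Rightarrow> real ^ 'n" where B: "linear B" "\<forall>i j. b (B (axis i 1)) (B (axis j 1)) = (if i = j then 1 else 0)"
    using inner_form_orthonormal_basis[OF assms] by blast
  show ?thesis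
    using det_form_matrix_orthonormal[OF assms B(1) B(2)[rule_format]]
    by (smt (verit) mult_nonneg_nonpos zero_le_power2)
qed

text \<open>The Leibniz sum has n! terms of modulus at most \<open>C ^ n\<close>. The estimate is
  crude, but any bound depending only on n and \<open>C\<close> serves the purpose.\<close>

lemma abs_det_le:
  fixes M :: "real ^ 'n ^ 'n"
  assumes "\<And>i j. \<bar>M $ i $ j\<bar> \<le> C"
  shows "\<bar>det M\<bar> \<le> fact CARD('n) * C ^ CARD('n)"
proof -
  have "\<bar>det M\<bar> \<le> (\<Sum>p | p permutes (UNIV :: 'n set). \<bar>of_int (sign p) * (\<Prod>i\<in>UNIV. M $ i $ p i)\<bar>)"
    unfolding det_def by (rule sum_abs)
  also have "\<dots> \<le> (\<Sum>p | p permutes (UNIV :: 'n set). C ^ CARD('n))"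
  proof (rule sum_mono)
    fix p :: "'n \<Rightarrow> 'n"
    have "\<bar>of_int (sign p) * (\<Prod>i\<in>UNIV. M $ i $ p i)\<bar> = (\<Prod>i\<in>UNIV. \<bar>M $ i $ p i\<bar>)"
      by (simp add: abs_mult abs_prod sign_def)
    also have "\<dots> \<le> (\<Prod>i\<in>(UNIV :: 'n set). C)"
      by (intro prod_mono) (simp add: assms)
    finally show "\<bar>of_int (sign p) * (\<Prod>i\<in>UNIV. M $ i $ p i)\<bar> \<le> C ^ CARD('n)" by simp
  qed
  also have "\<dots> = fact CARD('n) * C ^ CARD('n)"
    by (simp add: card_permutations[OF refl])
  finally show ?thesis .
qed

text \<open>In a basis orthonormal for \<open>b\<close> every matrix entry of \<open>b'\<close> is
  at most \<open>C\<close>. Passing to this basis multiplies both determinants by the same factor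
  \<open>D\<close>, which cancels at the end.\<close>

lemma det_form_matrix_le:
  fixes b b' :: "real ^ 'n \<Rightarrow> real ^ 'n \<Rightarrow> real"
  assumes b: "inner_form b" and b': "inner_form b'" and le: "\<And>v. b' v v \<le> C * b v v"
  shows "det (form_matrix b') \<le> fact CARD('n) * C ^ CARD('n) * det (form_matrix b)"
proof -
  obtain B :: "real ^ 'n \<Rightarrow> real ^ 'n" where B: "linear B" "\<forall>i j. b (B (axis i 1)) (B (axis j 1)) = (if i = j then 1 else 0)"
    using inner_form_orthonormal_basis[OF b] by blast
  have bil: "bilinear b'" and sym: "b' v w = b' w v" for v w
    using b' by (auto simp: inner_form_def)
  define D where "D = (det (matrix B))\<^sup>2"
  have D: "D * det (form_matrix b) = 1"
    using det_form_matrix_orthonormal[OF b B(1) B(2)[rule_format]] by (simp add: D_def)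
  then have Dpos: "D > 0"
    using det_form_matrix_pos[OF b] by (metis zero_less_mult_pos2 zero_less_one)
  have entry: "\<bar>b' (B (axis i 1)) (B (axis j 1))\<bar> \<le> C" for i j
  proof -
    let ?v = "B (axis i 1)" and ?w = "B (axis j 1)"
    \<comment> \<open>Polarization: positivity on the sum and on the difference controls the mixed
      term from both sides by the two diagonal terms.\<close>
    have "0 \<le> b' (?v + ?w) (?v + ?w)" "0 \<le> b' (?v - ?w) (?v - ?w)"
      by (rule inner_form_nonneg[OF b'])+
    then have "2 * \<bar>b' ?v ?w\<bar> \<le> b' ?v ?v + b' ?w ?w"
      using sym[of ?w ?v] by (simp add: bilinear_ladd[OF bil] bilinear_radd[OF bil]
          bilinear_lsub[OF bil] bilinear_rsub[OF bil])
    also have "\<dots> \<le> 2 * C" using le[of ?v] le[of ?w] B(2) by simp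
    finally show ?thesis by simp
  qed
  have "D * det (form_matrix b') = det (form_matrix (\<lambda>v w. b' (B v) (B w)))"
    by (simp add: det_form_matrix_pullback[OF bil B(1)] D_def)
  also have "\<dots> \<le> fact CARD('n) * C ^ CARD('n)"
    using abs_det_le[of "form_matrix (\<lambda>v w. b' (B v) (B w))" C] entry
    by (simp add: form_matrix_def)
  also have "\<dots> = D * (fact CARD('n) * C ^ CARD('n) * det (form_matrix b))"
    using D by (simp add: mult.left_commute[of D])
  finally show ?thesis using Dpos by simp
qed

section \<open>The endomorphism relating two inner products\<close>

lemma inner_form_eqI:
  assumes "inner_form b" "\<And>w. b u w = b v w"
  shows "u = v"
proof -
  have "b (u - v) (u - v) = 0"
    using assms(1) by (simp add: inner_form_def bilinear_lsub assms(2))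
  then show ?thesis using assms(1) unfolding inner_form_def by (metis less_irrefl right_minus_eq)
qed

lemma form_matrix_symmetric: "inner_form b \<Longrightarrow> transpose (form_matrix b) = form_matrix b"
  by (simp add: inner_form_def form_matrix_def transpose_def vec_eq_iff)

text \<open>Raising an index: this vector is the Riesz representative of the covector with
  components \<open>u\<close>.\<close>

lemma inner_form_represent:
  assumes "inner_form b"
  shows "b (matrix_inv (form_matrix b) *v u) w = u \<bullet> w"
proof -
  have sym: "b v w = b w v" and bil: "bilinear b" for v w using assms by (auto simp: inner_form_def)
  have "b (matrix_inv (form_matrix b) *v u) w = w \<bullet> (form_matrix b ** matrix_inv (form_matrix b) *v u)"
    by (subst sym) (simp add: form_matrix_inner[OF bil, of w] matrix_vector_mul_assoc)
  then show ?thesis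
    using det_form_matrix_pos[OF assms] by (simp add: matrix_inv_right_left inner_commute)
qed

text \<open>With matrices G' and G this is the endomorphism G'^(-1) G. Precomposing a covector with
  it converts the dual product of \<open>b'\<close> into the dual product of
  \<open>b\<close>.\<close>

definition form_map where
  "form_map b' b = (*v) (matrix_inv (form_matrix b') ** form_matrix b)"

lemma form_map:
  assumes "inner_form b'" "inner_form b"
  shows "b' (form_map b' b v) w = b v w"
proof -
  have "b' (form_map b' b v) w = (form_matrix b *v v) \<bullet> w"
    by (simp add: form_map_def inner_form_represent[OF assms(1)] flip: matrix_vector_mul_assoc)
  also have "\<dots> = b w v"
    using form_matrix_inner[of b w v] assms(2) by (simp add: inner_form_def inner_commute)
  finally show ?thesis using assms(2) by (simp add: inner_form_def)
qed

lemma linear_form_map: "linear (form_map b' b)"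
  by (simp add: form_map_def)

text \<open>The relation in the preceding lemma \<open>form_map\<close> determines the map without
  reference to a basis, hence it commutes with isomorphisms. This allows it to be computed in a
  chart frame, where the matrices depend smoothly on the point.\<close>

lemma form_map_pullback:
  assumes "inner_form b'" "inner_form b" "linear P" "bij P"
  shows "form_map b' b (P v) = P (form_map (\<lambda>v w. b' (P v) (P w)) (\<lambda>v w. b (P v) (P w)) v)"
proof (rule inner_form_eqI[OF assms(1)])
  fix w
  obtain u where w: "w = P u" using assms(4) by (metis bij_pointE)
  have inj: "inj P" using assms(4) by (rule bij_is_inj)
  show "b' (form_map b' b (P v)) w = b' (P (form_map (\<lambda>v w. b' (P v) (P w)) (\<lambda>v w. b (P v) (P w)) v)) w"
    unfolding w form_map[OF assms(1,2)]
    using form_map[OF inner_form_pullback[OF assms(1,3) inj] inner_form_pullback[OF assms(2,3) inj], of v u]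
    by simp
qed

section \<open>Dual inner products and norms of complex covectors\<close>

lemma cotangent_inner_form_matrix:
  "cotangent_inner g x a b = (\<Sum>i\<in>UNIV. \<Sum>j\<in>UNIV.
     of_real (matrix_inv (form_matrix (g x)) $ i $ j) * cnj (a (axis i 1)) * b (axis j 1))"
  by (simp add: cotangent_inner_def form_matrix_def)

lemma matrix_inv_form_matrix_symmetric:
  assumes "inner_form b"
  shows "transpose (matrix_inv (form_matrix b)) = matrix_inv (form_matrix b)"
proof -
  let ?G = "form_matrix b" and ?I = "matrix_inv (form_matrix b)"
  have inv: "?G ** ?I = mat 1" "?I ** ?G = mat 1"
    using det_form_matrix_pos[OF assms] by (auto simp: matrix_inv_right_left)
  have "transpose ?I = transpose ?I ** (?G ** ?I)" by (simp add: inv)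
  also have "\<dots> = transpose (?G ** ?I) ** ?I"
    by (simp add: matrix_transpose_mul form_matrix_symmetric[OF assms] matrix_mul_assoc)
  finally show ?thesis by (simp add: inv)
qed

text \<open>In matrices this is G^(-1) (G'^(-1) G)^T = G^(-1) G G'^(-1) = G'^(-1), by symmetry of G
  and of the inverse of G'.\<close>

lemma cotangent_inner_form_map:
  assumes g': "inner_form (g' x)" and g: "inner_form (g x)" and "linear \<alpha>"
  shows "cotangent_inner g x a (\<alpha> \<circ> form_map (g' x) (g x)) = cotangent_inner g' x a \<alpha>"
proof -
  let ?G = "form_matrix (g x)" and ?I = "matrix_inv (form_matrix (g x))"
    and ?I' = "matrix_inv (form_matrix (g' x))"
  have "?I ** transpose (?I' ** ?G) = (?I ** ?G) ** ?I'"
    by (simp add: matrix_transpose_mul matrix_inv_form_matrix_symmetric[OF g']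
        form_matrix_symmetric[OF g] matrix_mul_assoc)
  also have "\<dots> = ?I'"
    using det_form_matrix_pos[OF g] by (simp add: matrix_inv_right_left)
  finally have "(?I ** transpose (?I' ** ?G)) $ i $ k = ?I' $ i $ k" for i k by simp
  then have I': "(\<Sum>j\<in>UNIV. ?I $ i $ j * (?I' ** ?G) $ k $ j) = ?I' $ i $ k" for i k
    by (simp add: transpose_def matrix_matrix_mult_def[of ?I])
  have "(\<alpha> \<circ> form_map (g' x) (g x)) (axis j 1)
      = (\<Sum>k\<in>UNIV. of_real ((?I' ** ?G) $ k $ j) * \<alpha> (axis k 1))" for j
    using linear_sum_axis[OF assms(3), of "form_map (g' x) (g x) (axis j 1)"]
    by (simp add: form_map_def matrix_vector_mult_basis column_def scaleR_conv_of_real)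
  then have "cotangent_inner g x a (\<alpha> \<circ> form_map (g' x) (g x)) = (\<Sum>i\<in>UNIV. \<Sum>j\<in>UNIV. \<Sum>k\<in>UNIV.
      of_real (?I $ i $ j * (?I' ** ?G) $ k $ j) * cnj (a (axis i 1)) * \<alpha> (axis k 1))"
    by (simp add: cotangent_inner_form_matrix sum_distrib_left mult_ac)
  also have "\<dots> = (\<Sum>i\<in>UNIV. \<Sum>k\<in>UNIV. \<Sum>j\<in>UNIV.
      of_real (?I $ i $ j * (?I' ** ?G) $ k $ j) * cnj (a (axis i 1)) * \<alpha> (axis k 1))"
    by (intro sum.cong refl sum.swap)
  also have "\<dots> = (\<Sum>i\<in>UNIV. \<Sum>k\<in>UNIV. of_real (?I' $ i $ k) * cnj (a (axis i 1)) * \<alpha> (axis k 1))"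
    unfolding I'[symmetric] of_real_sum sum_distrib_right by simp
  finally show ?thesis by (simp add: cotangent_inner_form_matrix)
qed

lemma cotangent_inner_cmult:
  "cotangent_inner g x a (\<lambda>v. r *\<^sub>R b v) = r *\<^sub>R cotangent_inner g x a b"
  by (simp add: cotangent_inner_def scaleR_sum_right)

lemma cotangent_norm_scaleR:
  "r \<ge> 0 \<Longrightarrow> cotangent_norm g x (\<lambda>v. r *\<^sub>R a v) = r * cotangent_norm g x a"
proof -
  assume r: "r \<ge> 0"
  have "cotangent_inner g x (\<lambda>v. r *\<^sub>R a v) b = r *\<^sub>R cotangent_inner g x a b" for b
    by (simp add: cotangent_inner_def scaleR_sum_right)
  then show ?thesis
    using r by (simp add: cotangent_norm_def cotangent_inner_cmult real_sqrt_mult flip: mult.assoc)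
qed

text \<open>The Riesz map is an isometry on real covectors. Real and imaginary part contribute
  separately because the mixed products are purely imaginary.\<close>

lemma cotangent_norm_represent:
  assumes "inner_form (g x)" "\<And>v. a v = Complex (g x u v) (g x t v)"
  shows "cotangent_norm g x a = sqrt (g x u u + g x t t)"
proof -
  let ?G = "form_matrix (g x)" and ?I = "matrix_inv (form_matrix (g x))"
  have sym: "g x v w = g x w v" and bil: "bilinear (g x)" for v w
    using assms(1) by (auto simp: inner_form_def)
  have quad: "(\<Sum>i\<in>UNIV. \<Sum>j\<in>UNIV. ?I $ i $ j * g x u (axis i 1) * g x u (axis j 1)) = g x u u" for u
  proof -
    have "(\<Sum>i\<in>UNIV. \<Sum>j\<in>UNIV. ?I $ i $ j * g x u (axis i 1) * g x u (axis j 1))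
        = (?G *v u) \<bullet> (?I *v (?G *v u))"
      by (simp add: inner_vec_def form_matrix_mult[OF bil] sym[of u] matrix_vector_mult_def[of ?I]
          sum_distrib_left mult_ac)
    also have "\<dots> = u \<bullet> (?G *v u)"
      using det_form_matrix_pos[OF assms(1)]
      by (simp add: matrix_inv_right_left matrix_vector_mul_assoc inner_commute)
    finally show ?thesis by (simp add: form_matrix_inner[OF bil, of u u])
  qed
  have "Re (cotangent_inner g x a a) = (\<Sum>i\<in>UNIV. \<Sum>j\<in>UNIV.
      ?I $ i $ j * g x u (axis i 1) * g x u (axis j 1) + ?I $ i $ j * g x t (axis i 1) * g x t (axis j 1))"
    by (simp add: cotangent_inner_form_matrix assms(2) algebra_simps)
  then show ?thesis by (simp add: cotangent_norm_def sum.distrib quad)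
qed

text \<open>The vectors \<open>u\<close> and \<open>t\<close> that represent the real and imaginary
  part of \<alpha> through \<open>g'\<close> also represent those of the transferred covector
  through \<open>g\<close>. Hence the comparison of tangent norms applies to them directly and need
  not be dualized.\<close>

lemma cotangent_norm_form_map_le:
  fixes g g' :: "('m, 'n::finite) metric"
  assumes g': "inner_form (g' x)" and g: "inner_form (g x)" and "linear \<alpha>"
    and C: "C \<ge> 0" "\<And>v. g x v v \<le> C\<^sup>2 * g' x v v"
  shows "cotangent_norm g x (\<alpha> \<circ> form_map (g' x) (g x)) \<le> C * cotangent_norm g' x \<alpha>"
proof -
  have "\<exists>u. \<forall>v. f v = g' x u v" if "linear f" for f :: "real ^ 'n \<Rightarrow> real"
  proof (intro exI allI)
    fix v
    show "f v = g' x (matrix_inv (form_matrix (g' x)) *v (\<chi> i. f (axis i 1))) v"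
      unfolding inner_form_represent[OF g'] using linear_sum_axis[OF that, of v]
      by (simp add: inner_vec_def mult.commute)
  qed
  from this[OF linear_compose[OF assms(3) bounded_linear.linear[OF bounded_linear_Re]]] this[OF linear_compose[OF assms(3) bounded_linear.linear[OF bounded_linear_Im]]]
  obtain u t where ut: "\<And>v. Re (\<alpha> v) = g' x u v" "\<And>v. Im (\<alpha> v) = g' x t v"
    by auto
  then have "\<alpha> v = Complex (g' x u v) (g' x t v)" for v by (simp add: complex_eq_iff)
  moreover have "(\<alpha> \<circ> form_map (g' x) (g x)) v = Complex (g x u v) (g x t v)" for v
  proof -
    have "g' x w (form_map (g' x) (g x) v) = g x w v" for w
      using form_map[OF g' g, of v w] g g' unfolding inner_form_def by metis
    then show ?thesis using ut by (simp add: complex_eq_iff)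
  qed
  ultimately have "cotangent_norm g' x \<alpha> = sqrt (g' x u u + g' x t t)"
    "cotangent_norm g x (\<alpha> \<circ> form_map (g' x) (g x)) = sqrt (g x u u + g x t t)"
    using cotangent_norm_represent[of g' x] cotangent_norm_represent[of g x] g g' by blast+
  moreover have "sqrt (g x u u + g x t t) \<le> sqrt (C\<^sup>2 * (g' x u u + g' x t t))"
    using C(2)[of u] C(2)[of t] by (simp add: distrib_left)
  ultimately show ?thesis using C(1) by (simp add: real_sqrt_mult)
qed

subsection \<open>Charts and coordinate frames\<close>

lemma is_chart_simps:
  assumes "is_chart c"
  shows "open (cdom c)" "open (crange c)" "continuous_on (cdom c) (coord c)"
    "continuous_on (crange c) (cinv c)" "inj_on (coord c) (cdom c)"
    and "x \<in> cdom c \<Longrightarrow> coord c x \<in> crange c"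
    and "x \<in> cdom c \<Longrightarrow> cinv c (coord c x) = x"
    and "y \<in> crange c \<Longrightarrow> cinv c y \<in> cdom c"
    and "y \<in> crange c \<Longrightarrow> coord c (cinv c y) = y"
  using assms unfolding is_chart_def homeomorphism_def inj_on_def by (auto, metis)

lemma chart_image_eq:
  assumes "is_chart c" "S \<subseteq> cdom c"
  shows "coord c ` S = crange c \<inter> cinv c -` S"
  using assms(2) is_chart_simps[OF assms(1)] by (auto simp: image_iff subset_iff) (metis)

lemma open_chart_image:
  assumes "is_chart c" "open U" "U \<subseteq> cdom c"
  shows "open (coord c ` U)"
  unfolding chart_image_eq[OF assms(1,3)]
  using is_chart_simps[OF assms(1)] assms(2) by (intro continuous_open_preimage)

lemma smooth_fun_continuous:
  assumes "smooth_atlas A" "smooth_fun A u"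
  shows "continuous_on UNIV u"
proof -
  have "continuous_on (cdom c) u" if "c \<in> A" for c
  proof -
    have c: "is_chart c" using assms(1) that by (simp add: smooth_atlas_def)
    have "continuous_on (crange c) (u \<circ> cinv c)"
      using assms(2) that unfolding smooth_fun_def by (blast intro: smooth_on_continuous_on)
    then have "continuous_on (cdom c) ((u \<circ> cinv c) \<circ> coord c)"
      using is_chart_simps(3)[OF c] by (intro continuous_on_compose[of _ "coord c"]) (simp_all add: crange_def)
    then show ?thesis
      using is_chart_simps(7)[OF c] by (simp cong: continuous_on_cong)
  qed
  then have "continuous_on (\<Union>c\<in>A. cdom c) u"
    using assms(1) by (intro continuous_on_open_UN) (auto simp: smooth_atlas_def is_chart_def)
  then show ?thesis using assms(1) by (simp add: smooth_atlas_def)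
qed

text \<open>The Jacobian of a change of coordinates, indexed by the point of the manifold and not by
  its coordinates, so that the cocycle rule becomes a plain composition.\<close>

definition transition_deriv ::
  "('m, 'n::finite) chart \<Rightarrow> ('m, 'n) chart \<Rightarrow> 'm \<Rightarrow> real ^ 'n \<Rightarrow> real ^ 'n" where
  "transition_deriv c c' x = frechet_derivative (coord c' \<circ> cinv c) (at (coord c x))"

locale smooth_manifold =
  fixes A :: "('m::second_countable_topology, 'n::finite) chart set"
  assumes atlas: "smooth_atlas A"
begin

lemma chart [simp]: "c \<in> A \<Longrightarrow> is_chart c"
  using atlas by (simp add: smooth_atlas_def)

lemma has_derivative_transition:
  assumes "c \<in> A" "c' \<in> A" "x \<in> cdom c" "x \<in> cdom c'"
  shows "(coord c' \<circ> cinv c has_derivative transition_deriv c c' x) (at (coord c x))"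
  unfolding transition_deriv_def
proof (rule smooth_on_has_derivative)
  show "smooth_on (coord c ` (cdom c \<inter> cdom c')) (coord c' \<circ> cinv c)"
    using atlas assms by (simp add: smooth_atlas_def)
qed (use assms in simp)

lemma linear_transition_deriv:
  "c \<in> A \<Longrightarrow> c' \<in> A \<Longrightarrow> x \<in> cdom c \<Longrightarrow> x \<in> cdom c' \<Longrightarrow> linear (transition_deriv c c' x)"
  by (rule has_derivative_linear[OF has_derivative_transition])

text \<open>This is the chain rule. The composed coordinate change agrees with the direct one only
  over the overlap of the first two charts, so equality near the point is used.\<close>

lemma transition_deriv_compose:
  assumes c: "c \<in> A" "c' \<in> A" "c'' \<in> A" and x: "x \<in> cdom c" "x \<in> cdom c'" "x \<in> cdom c''"
  shows "transition_deriv c c'' x = transition_deriv c' c'' x \<circ> transition_deriv c c' x"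
proof (rule has_derivative_unique[OF has_derivative_transition[OF c(1,3) x(1,3)]])
  let ?U = "coord c ` (cdom c \<inter> cdom c')"
  have "(coord c' \<circ> cinv c) (coord c x) = coord c' x"
    using x(1) is_chart_simps(7)[OF chart[OF c(1)]] by simp
  then have "((coord c'' \<circ> cinv c') \<circ> (coord c' \<circ> cinv c) has_derivative
      transition_deriv c' c'' x \<circ> transition_deriv c c' x) (at (coord c x))"
    using has_derivative_transition[OF c(2,3) x(2,3)]
    by (intro diff_chain_at[OF has_derivative_transition[OF c(1,2) x(1,2)]]) (simp only:)
  then show "(coord c'' \<circ> cinv c has_derivative
      transition_deriv c' c'' x \<circ> transition_deriv c c' x) (at (coord c x))"
  proof (rule has_derivative_transform_within_open)
    show "open ?U"
      using c by (intro open_chart_image open_Int is_chart_simps(1) chart) auto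
    show "coord c x \<in> ?U" using x by blast
    show "((coord c'' \<circ> cinv c') \<circ> (coord c' \<circ> cinv c)) y = (coord c'' \<circ> cinv c) y"
      if "y \<in> ?U" for y
      using that is_chart_simps(7)[OF chart[OF c(1)]] is_chart_simps(7)[OF chart[OF c(2)]] by auto
  qed
qed

lemma transition_deriv_same:
  assumes c: "c \<in> A" and x: "x \<in> cdom c"
  shows "transition_deriv c c x = id"
proof -
  have "(coord c \<circ> cinv c has_derivative id) (at (coord c x))"
    using c x by (intro has_derivative_transform_within_open[OF has_derivative_id, of "crange c"])
      (auto simp: is_chart_simps id_def)
  then show ?thesis
    by (rule has_derivative_unique[OF has_derivative_transition[OF c c x x]])
qed

lemma bij_transition_deriv:
  assumes c: "c \<in> A" "c' \<in> A" and x: "x \<in> cdom c" "x \<in> cdom c'"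
  shows "bij (transition_deriv c c' x)"
  using transition_deriv_compose[OF c c(1) x x(1)] transition_deriv_compose[OF c(2,1,2) x(2,1,2)]
  by (intro o_bij[of "transition_deriv c' c x"]) (simp_all add: transition_deriv_same assms)

lemma chart_at: "chart_at A x \<in> A" "x \<in> cdom (chart_at A x)"
proof -
  have "\<exists>c. c \<in> A \<and> x \<in> cdom c" using atlas unfolding smooth_atlas_def by blast
  then have "chart_at A x \<in> A \<and> x \<in> cdom (chart_at A x)"
    unfolding chart_at_def by (rule someI_ex)
  then show "chart_at A x \<in> A" "x \<in> cdom (chart_at A x)" by auto
qed

text \<open>Tangent vectors are stored as components in the selected chart, so a coordinate frame is
  a transition into that chart and inherits linearity, bijectivity and the cocycle rule.\<close>

lemma chart_vec_eq: "chart_vec A c x = transition_deriv c (chart_at A x) x"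
  by (simp add: chart_vec_def transition_deriv_def)

lemma linear_chart_vec: "c \<in> A \<Longrightarrow> x \<in> cdom c \<Longrightarrow> linear (chart_vec A c x)"
  and bij_chart_vec: "c \<in> A \<Longrightarrow> x \<in> cdom c \<Longrightarrow> bij (chart_vec A c x)"
  by (simp_all add: chart_vec_eq linear_transition_deriv bij_transition_deriv chart_at)

lemma chart_vec_transition:
  "c \<in> A \<Longrightarrow> c' \<in> A \<Longrightarrow> x \<in> cdom c \<Longrightarrow> x \<in> cdom c' \<Longrightarrow>
    chart_vec A c x = chart_vec A c' x \<circ> transition_deriv c c' x"
  unfolding chart_vec_eq by (intro transition_deriv_compose chart_at)

definition frame_form :: "('m, 'n) metric \<Rightarrow> ('m, 'n) chart \<Rightarrow> 'm \<Rightarrow> real ^ 'n \<Rightarrow> real ^ 'n \<Rightarrow> real" where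
  "frame_form g c x = (\<lambda>v w. g x (chart_vec A c x v) (chart_vec A c x w))"

lemma gram_eq: "gram A g c y = form_matrix (frame_form g c (cinv c y))"
  by (simp add: gram_def form_matrix_def frame_form_def)

lemma riemannian_metric_inner_form: "riemannian_metric A g \<Longrightarrow> inner_form (g x)"
  by (simp add: riemannian_metric_def inner_form_def)

lemma inner_form_frame_form:
  assumes "riemannian_metric A g" "c \<in> A" "x \<in> cdom c"
  shows "inner_form (frame_form g c x)"
  unfolding frame_form_def
  using inner_form_pullback[OF riemannian_metric_inner_form linear_chart_vec
      bij_is_inj[OF bij_chart_vec]] assms by blast

lemma det_gram_pos:
  "riemannian_metric A g \<Longrightarrow> c \<in> A \<Longrightarrow> y \<in> crange c \<Longrightarrow> det (gram A g c y) > 0"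
  unfolding gram_eq by (intro det_form_matrix_pos inner_form_frame_form) (auto simp: is_chart_simps)

lemma smooth_on_gram:
  "riemannian_metric A g \<Longrightarrow> c \<in> A \<Longrightarrow> smooth_on (crange c) (\<lambda>y. gram A g c y $ i $ j)"
  by (simp add: gram_def riemannian_metric_def)

lemma smooth_on_det_gram:
  "riemannian_metric A g \<Longrightarrow> c \<in> A \<Longrightarrow> smooth_on (crange c) (\<lambda>y. det (gram A g c y))"
  by (intro smooth_on_det smooth_on_gram) (auto simp: is_chart_simps)

text \<open>The factor is exactly the Jacobian of the change of variables formula, so the chart
  densities will describe one and the same measure on overlaps.\<close>

lemma sqrt_det_gram_transition:
  assumes g: "riemannian_metric A g" and c: "c \<in> A" "c' \<in> A" and x: "x \<in> cdom c" "x \<in> cdom c'"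
  shows "sqrt (det (gram A g c (coord c x)))
    = \<bar>det (matrix (transition_deriv c c' x))\<bar> * sqrt (det (gram A g c' (coord c' x)))"
proof -
  have "frame_form g c x
      = (\<lambda>v w. frame_form g c' x (transition_deriv c c' x v) (transition_deriv c c' x w))"
    by (simp add: frame_form_def chart_vec_transition[OF c x])
  moreover have "bilinear (frame_form g c' x)"
    using inner_form_frame_form[OF g c(2) x(2)] by (simp add: inner_form_def)
  ultimately have "det (form_matrix (frame_form g c x))
      = (det (matrix (transition_deriv c c' x)))\<^sup>2 * det (form_matrix (frame_form g c' x))"
    using det_form_matrix_pullback[OF _ linear_transition_deriv[OF c x]] by simp
  then have "det (gram A g c (coord c x))
      = (det (matrix (transition_deriv c c' x)))\<^sup>2 * det (gram A g c' (coord c' x))"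
    using c x by (simp add: gram_eq is_chart_simps)
  then show ?thesis by (simp add: real_sqrt_mult)
qed

text \<open>The density of the second volume with respect to the first. Each determinant refers to
  the selected frame, which jumps with \<open>x\<close>, but their quotient is the same in every
  basis; hence it can be smooth.\<close>

definition vol_ratio :: "('m, 'n) metric \<Rightarrow> ('m, 'n) metric \<Rightarrow> 'm \<Rightarrow> real" where
  "vol_ratio g g' x = sqrt (det (form_matrix (g' x)) / det (form_matrix (g x)))"

lemma vol_ratio_pos:
  "riemannian_metric A g \<Longrightarrow> riemannian_metric A g' \<Longrightarrow> vol_ratio g g' x > 0"
  by (simp add: vol_ratio_def det_form_matrix_pos riemannian_metric_inner_form)

lemma vol_ratio_gram:
  assumes g: "riemannian_metric A g" "riemannian_metric A g'" and c: "c \<in> A" "y \<in> crange c"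
  shows "vol_ratio g g' (cinv c y) * sqrt (det (gram A g c y)) = sqrt (det (gram A g' c y))"
proof -
  let ?x = "cinv c y"
  let ?d = "det (matrix (chart_vec A c ?x))"
  have x: "?x \<in> cdom c" using c by (simp add: is_chart_simps)
  have "det (gram A h c y) = ?d\<^sup>2 * det (form_matrix (h ?x))" if "riemannian_metric A h" for h
    unfolding gram_eq frame_form_def
    using riemannian_metric_inner_form[OF that, of ?x] linear_chart_vec[OF c(1) x]
      det_form_matrix_pullback[of "h ?x" "chart_vec A c ?x"] by (simp add: inner_form_def)
  then show ?thesis
    using g det_form_matrix_pos[OF riemannian_metric_inner_form[OF g(1), of ?x]]
    by (simp add: vol_ratio_def real_sqrt_mult real_sqrt_divide)
qed

lemma smooth_fun_vol_ratio:
  assumes g: "riemannian_metric A g" "riemannian_metric A g'"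
  shows "smooth_fun A (vol_ratio g g')"
  unfolding smooth_fun_def
proof
  fix c assume c: "c \<in> A"
  have "smooth_on (crange c)
      (\<lambda>y. det (gram A g' c y) powr (1 / 2) * det (gram A g c y) powr (- (1 / 2)))"
    using c g by (intro smooth_on_mult smooth_on_powr smooth_on_det_gram det_gram_pos)
      (auto simp: is_chart_simps)
  then show "smooth_on (crange c) (vol_ratio g g' \<circ> cinv c)"
  proof (rule smooth_on_cong[rotated 2])
    fix y assume y: "y \<in> crange c"
    show "det (gram A g' c y) powr (1 / 2) * det (gram A g c y) powr (- (1 / 2))
        = (vol_ratio g g' \<circ> cinv c) y"
      using vol_ratio_gram[OF g c y] det_gram_pos[OF g(1) c y] det_gram_pos[OF g(2) c y]
      by (simp add: powr_minus powr_half_sqrt field_simps)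
  qed (use c in \<open>simp add: is_chart_simps\<close>)
qed

lemma smooth_fun_scaleR:
  "smooth_fun A r \<Longrightarrow> smooth_fun A h \<Longrightarrow> smooth_fun A (\<lambda>x. r x *\<^sub>R h x)"
  by (auto simp: smooth_fun_def o_def is_chart_simps intro!: smooth_on_scaleR)

text \<open>The form \<open>\<beta>\<close> with \<open>g(a, \<beta>) = r g'(a, \<alpha>)\<close> for all covectors \<open>a\<close>.\<close>

definition transfer_form where
  "transfer_form g g' r \<alpha> = (\<lambda>x v. r x *\<^sub>R \<alpha> x (form_map (g' x) (g x) v))"

lemma test_form_transfer_form:
  assumes g: "riemannian_metric A g" "riemannian_metric A g'"
    and r: "smooth_fun A r" and \<alpha>: "test_form A \<alpha>"
  shows "test_form A (transfer_form g g' r \<alpha>)"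
  unfolding test_form_def
proof (intro conjI allI ballI)
  have lin: "linear (\<alpha> x)" for x using \<alpha> by (simp add: test_form_def)
  show "linear (transfer_form g g' r \<alpha> x)" for x
    using linear_compose_scale_right[OF linear_compose[OF linear_form_map[of "g' x" "g x"] lin[of x]]]
    by (simp add: transfer_form_def o_def)
  fix c v assume c: "c \<in> A"
  let ?P = "\<lambda>y. chart_vec A c (cinv c y)"
  \<comment> \<open>The components, in the frame of \<open>c\<close>, of the image of the frame
    vector \<open>v\<close> under \<open>form_map\<close>. In this frame the matrices of both
    metrics are smooth, so Cramer's rule applies.\<close>
  let ?u = "\<lambda>y. matrix_inv (gram A g' c y) *v (gram A g c y *v v)"
  have op: "open (crange c)" using c by (simp add: is_chart_simps)
  have "smooth_on (crange c) (\<lambda>y. \<Sum>j\<in>UNIV. gram A g c y $ i $ j * v $ j)" for i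
    by (intro smooth_on_sum smooth_on_mult smooth_on_gram smooth_on_const op g c)
  then have "smooth_on (crange c) (\<lambda>y. (gram A g c y *v v) $ i)" for i
    by (simp add: matrix_vector_mult_def)
  then have u: "smooth_on (crange c) (\<lambda>y. ?u y $ i)" for i
    by (intro smooth_on_solve smooth_on_gram det_gram_pos g op c)
  have "smooth_on (crange c) (\<lambda>y. \<alpha> (cinv c y) (?P y w))" for w
    using \<alpha> c by (simp add: test_form_def)
  moreover have "smooth_on (crange c) (\<lambda>y. r (cinv c y))"
    using r c by (simp add: smooth_fun_def o_def)
  ultimately have "smooth_on (crange c)
      (\<lambda>y. r (cinv c y) *\<^sub>R (\<Sum>i\<in>UNIV. ?u y $ i *\<^sub>R \<alpha> (cinv c y) (?P y (axis i 1))))"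
    by (intro smooth_on_scaleR smooth_on_sum u op)
  then show "smooth_on (crange c) (\<lambda>y. transfer_form g g' r \<alpha> (cinv c y) (?P y v))"
  proof (rule smooth_on_cong[OF op, rotated])
    fix y assume y: "y \<in> crange c"
    let ?x = "cinv c y"
    have x: "?x \<in> cdom c" using c y by (simp add: is_chart_simps)
    note P = linear_chart_vec[OF c x] bij_chart_vec[OF c x]
    have "form_map (g' ?x) (g ?x) (?P y v)
        = ?P y (form_map (frame_form g' c ?x) (frame_form g c ?x) v)"
      unfolding frame_form_def
      by (rule form_map_pullback[OF riemannian_metric_inner_form[OF g(2)]
            riemannian_metric_inner_form[OF g(1)] P])
    also have "form_map (frame_form g' c ?x) (frame_form g c ?x) v = ?u y"
      by (simp add: gram_eq form_map_def matrix_vector_mul_assoc)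
    finally have map: "form_map (g' ?x) (g ?x) (?P y v) = ?P y (?u y)" .
    have "\<alpha> ?x (form_map (g' ?x) (g ?x) (?P y v))
        = (\<Sum>i\<in>UNIV. ?u y $ i *\<^sub>R \<alpha> ?x (?P y (axis i 1)))"
      unfolding map using linear_sum_axis[OF linear_compose[OF P(1) lin[of ?x]], of "?u y"]
      by (simp only: o_def)
    then show "r ?x *\<^sub>R (\<Sum>i\<in>UNIV. ?u y $ i *\<^sub>R \<alpha> ?x (?P y (axis i 1)))
        = transfer_form g g' r \<alpha> ?x (?P y v)"
      by (simp add: transfer_form_def)
  qed
next
  \<comment> \<open>The transferred form vanishes wherever \<alpha> does, so its support is a closed
    subset of a compact set.\<close>
  have "{x. transfer_form g g' r \<alpha> x \<noteq> (\<lambda>v. 0)} \<subseteq> {x. \<alpha> x \<noteq> (\<lambda>v. 0)}"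
    by (auto simp: transfer_form_def)
  then have "closure {x. \<alpha> x \<noteq> (\<lambda>v. 0)} \<inter> closure {x. transfer_form g g' r \<alpha> x \<noteq> (\<lambda>v. 0)}
      = closure {x. transfer_form g g' r \<alpha> x \<noteq> (\<lambda>v. 0)}"
    by (intro Int_absorb1 closure_mono)
  moreover have "compact (closure {x. \<alpha> x \<noteq> (\<lambda>v. 0)})" using \<alpha> by (simp add: test_form_def)
  ultimately show "compact (closure {x. transfer_form g g' r \<alpha> x \<noteq> (\<lambda>v. 0)})"
    using compact_Int_closed[OF _ closed_closure] by metis
qed

end

subsection \<open>Change of variables for nonnegative integrals\<close>

text \<open>A bridge between absolute integrability over a set and nonnegative integrals for
  \<open>lborel\<close>: the first claim identifies the infinite case, the second the value in the
  finite case.\<close>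

lemma absolutely_integrable_iff_nn_integral:
  fixes h :: "'a::euclidean_space \<Rightarrow> real"
  assumes "\<And>x. h x \<ge> 0" and meas: "(\<lambda>x. indicator S x * h x) \<in> borel_measurable borel"
  shows "h absolutely_integrable_on S \<longleftrightarrow> (\<integral>\<^sup>+x\<in>S. ennreal (h x) \<partial>lborel) < \<infinity>"
    and "h absolutely_integrable_on S \<Longrightarrow> (\<integral>\<^sup>+x\<in>S. ennreal (h x) \<partial>lborel) = ennreal (integral S h)"
proof -
  let ?h = "\<lambda>x. indicator S x * h x"
  have nn: "(\<integral>\<^sup>+x. ennreal (?h x) \<partial>lborel) = (\<integral>\<^sup>+x\<in>S. ennreal (h x) \<partial>lborel)"
    by (intro nn_integral_cong) (auto split: split_indicator)
  have iff: "h absolutely_integrable_on S \<longleftrightarrow> integrable lborel ?h"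
    using integrable_completion[of ?h lborel] meas by (simp add: set_integrable_def)
  then show "h absolutely_integrable_on S \<longleftrightarrow> (\<integral>\<^sup>+x\<in>S. ennreal (h x) \<partial>lborel) < \<infinity>"
    using meas assms(1) nn by (simp add: integrable_iff_bounded)
  assume h: "h absolutely_integrable_on S"
  have "integral S h = (\<integral>x. ?h x \<partial>lborel)"
    using set_lebesgue_integral_eq_integral(2)[OF h] integral_completion[of ?h lborel] meas
    by (simp add: set_lebesgue_integral_def)
  moreover have "(\<integral>\<^sup>+x. ennreal (?h x) \<partial>lborel) = ennreal (\<integral>x. ?h x \<partial>lborel)"
    using h iff assms(1) by (intro nn_integral_eq_integral) auto
  ultimately show "(\<integral>\<^sup>+x\<in>S. ennreal (h x) \<partial>lborel) = ennreal (integral S h)"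
    by (simp add: nn)
qed

text \<open>The theorem on absolutely integrable functions is an equivalence, so it also decides the
  infinite case: if one side fails to be integrable then so does the other, and both nonnegative
  integrals are infinite.\<close>

lemma nn_integral_change_of_variables_wellorder:
  fixes g :: "real ^ 'm::{finite,wellorder} \<Rightarrow> real ^ 'm::_" and f :: "real ^ 'm::_ \<Rightarrow> real"
  assumes S: "S \<in> sets borel" and der: "\<And>x. x \<in> S \<Longrightarrow> (g has_derivative g' x) (at x within S)"
    and inj: "inj_on g S" and nonneg: "\<And>y. f y \<ge> 0"
    and meas: "(\<lambda>y. indicator (g ` S) y * f y) \<in> borel_measurable borel"
      "(\<lambda>x. indicator S x * (\<bar>det (matrix (g' x))\<bar> * f (g x))) \<in> borel_measurable borel"
  shows "(\<integral>\<^sup>+y\<in>g ` S. ennreal (f y) \<partial>lborel)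
    = (\<integral>\<^sup>+x\<in>S. ennreal (\<bar>det (matrix (g' x))\<bar> * f (g x)) \<partial>lborel)"
proof -
  let ?D = "\<lambda>x. \<bar>det (matrix (g' x))\<bar> * f (g x)"
  have "S \<in> sets lebesgue" using S by simp
  \<comment> \<open>The theorem concerns vector-valued integrands, so the scalar function is read as
    one with values in \<open>real ^ 1\<close>.\<close>
  from has_absolute_integral_change_of_variables[OF this der inj, of "\<lambda>y. vec (f y) :: real ^ 1" "vec b" for b]
  have cov: "?D absolutely_integrable_on S \<and> integral S ?D = b
      \<longleftrightarrow> f absolutely_integrable_on (g ` S) \<and> integral (g ` S) f = b" for b
    by (simp add: absolutely_integrable_on_1_iff integral_on_1_eq vec_eq_iff)
  note f = absolutely_integrable_iff_nn_integral[OF nonneg meas(1)]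
    and D = absolutely_integrable_iff_nn_integral[of ?D S, OF _ meas(2)]
  show ?thesis
  proof (cases "f absolutely_integrable_on (g ` S)")
    case True
    then show ?thesis using cov[of "integral (g ` S) f"] f(2) D(2) nonneg by simp
  next
    case False
    then have "\<not> ?D absolutely_integrable_on S" using cov by blast
    then show ?thesis using False f(1) D(1) nonneg by (simp add: less_top[symmetric])
  qed
qed

text \<open>The library theorem needs a well-ordered index type, so the coordinates are renumbered.\<close>

typedef (overloaded) ('n::finite) index = "{..<CARD('n)}"
  by (auto intro: exI[of _ 0])

instance index :: (finite) finite
proof
  have "inj (Rep_index :: 'a index \<Rightarrow> nat)" by (simp add: inj_def Rep_index_inject)
  moreover have "range (Rep_index :: 'a index \<Rightarrow> nat) \<subseteq> {..<CARD('a)}"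
    using Rep_index by blast
  ultimately show "finite (UNIV :: 'a index set)"
    by (meson finite_imageD finite_lessThan finite_subset)
qed

instantiation index :: (finite) wellorder
begin

definition "i \<le> j \<longleftrightarrow> Rep_index i \<le> Rep_index j" for i j :: "'a index"
definition "i < j \<longleftrightarrow> Rep_index i < Rep_index j" for i j :: "'a index"

instance
proof
  fix P and a :: "'a index"
  assume "\<And>x. (\<And>y :: 'a index. y < x \<Longrightarrow> P y) \<Longrightarrow> P x"
  then show "P a"
    by (rule measure_induct_rule[of Rep_index P a, rotated]) (simp only: less_index_def)
qed (auto simp: less_index_def less_eq_index_def Rep_index_inject)

end

lemma index_bij: "\<exists>f :: 'n::finite index \<Rightarrow> 'n. bij f"
proof -
  have "CARD('n index) = CARD('n)"
    using type_definition.card[OF type_definition_index] by simp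
  then show ?thesis by (intro finite_same_card_bij) auto
qed

text \<open>Since \<open>f\<close> may join two different types, its own sign makes no sense and
  cannot be cancelled. Instead a product of transpositions is conjugated factor by factor: the
  transposition of \<open>a\<close> and \<open>b\<close> becomes that of \<open>f a\<close> and
  \<open>f b\<close>.\<close>

lemma sign_conjugate:
  assumes "bij f" "permutation p"
  shows "sign (f \<circ> p \<circ> inv f) = sign p"
proof -
  have "swapidseq n (f \<circ> q \<circ> inv f)" if "swapidseq n q" for n q
    using that
  proof (induction rule: swapidseq.induct)
    case id
    have "f \<circ> inv f = id" using assms(1) surj_iff bij_is_surj by blast
    then have "f \<circ> id \<circ> inv f = id" by (simp only: comp_id)
    then show ?case by (simp only: swapidseq.id)
  next
    case (comp_Suc n q a b)
    have "f \<circ> (Transposition.transpose a b \<circ> q) \<circ> inv f = Transposition.transpose (f a) (f b) \<circ> (f \<circ> q \<circ> inv f)"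
      using bij_is_inj[OF assms(1)] by (auto simp: fun_eq_iff Transposition.transpose_def inj_eq)
    moreover have "f a \<noteq> f b" using comp_Suc.hyps(2) bij_is_inj[OF assms(1)] by (simp add: inj_eq)
    ultimately show ?case using swapidseq.comp_Suc[OF comp_Suc.IH] by (simp only:)
  qed
  moreover obtain n where "swapidseq n p" using assms(2) by (auto simp: permutation_def)
  ultimately show ?thesis by (metis evenperm_unique sign_def)
qed

text \<open>Conjugation by \<open>f\<close> is a sign-preserving bijection between the permutations
  of the two index types, and it matches the Leibniz sums term by term.\<close>

lemma det_reindex:
  fixes M :: "real ^ 'n ^ 'n" and f :: "'m::finite \<Rightarrow> 'n"
  assumes "bij f"
  shows "det (\<chi> i j. M $ f i $ f j) = det M"
proof -
  have f: "f (inv f x) = x" "inv f (f y) = y" for x y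
    using assms by (simp_all add: bij_is_surj surj_f_inv_f bij_is_inj)
  have eq: "of_int (sign p) * (\<Prod>i\<in>UNIV. M $ f i $ f (p i))
      = of_int (sign (f \<circ> p \<circ> inv f)) * (\<Prod>k\<in>UNIV. M $ k $ (f \<circ> p \<circ> inv f) k)"
    if "p permutes UNIV" for p
  proof -
    have "sign (f \<circ> p \<circ> inv f) = sign p"
      using that by (intro sign_conjugate assms) (auto simp: permutation_permutes)
    moreover have "(\<Prod>k\<in>UNIV. M $ k $ (f \<circ> p \<circ> inv f) k) = (\<Prod>i\<in>UNIV. M $ f i $ f (p i))"
      using prod.reindex_bij_betw[OF assms, of "\<lambda>k. M $ k $ (f \<circ> p \<circ> inv f) k"] by (simp add: f)
    ultimately show ?thesis by simp
  qed
  have bij: "bij_betw (\<lambda>p. f \<circ> p \<circ> inv f) {p. p permutes UNIV} {q. q permutes UNIV}"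
  proof (rule bij_betw_byWitness[where f' = "\<lambda>q. inv f \<circ> q \<circ> f"])
    show "(\<lambda>p. f \<circ> p \<circ> inv f) ` {p. p permutes UNIV} \<subseteq> {q. q permutes UNIV}"
      "(\<lambda>q. inv f \<circ> q \<circ> f) ` {q. q permutes UNIV} \<subseteq> {p. p permutes UNIV}"
      using assms by (auto intro!: bij_imp_permutes bij_comp bij_imp_bij_inv permutes_bij)
  qed (simp_all add: fun_eq_iff f)
  have "det (\<chi> i j. M $ f i $ f j) = (\<Sum>p | p permutes UNIV.
      of_int (sign (f \<circ> p \<circ> inv f)) * (\<Prod>k\<in>UNIV. M $ k $ (f \<circ> p \<circ> inv f) k))"
    unfolding det_def by (intro sum.cong refl) (simp only: vec_lambda_beta eq mem_Collect_eq)
  also have "\<dots> = det M"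
    unfolding det_def by (rule sum.reindex_bij_betw[OF bij])
  finally show ?thesis .
qed

definition reindex :: "('m::finite \<Rightarrow> 'n) \<Rightarrow> real ^ 'n \<Rightarrow> real ^ 'm" where
  "reindex f x = (\<chi> i. x $ f i)"

lemma linear_reindex: "linear (reindex f)"
  by (auto intro!: linearI simp: reindex_def vec_eq_iff)

lemma borel_measurable_reindex [measurable]: "reindex f \<in> borel_measurable borel"
  by (intro borel_measurable_continuous_onI linear_continuous_on linear_conv_bounded_linear[THEN iffD1]
      linear_reindex)

lemma prod_Basis_vec:
  fixes v :: "real ^ 'n"
  shows "(\<Prod>b\<in>Basis. v \<bullet> b) = (\<Prod>i\<in>UNIV. v $ i)"
proof -
  have "bij_betw (\<lambda>i :: 'n. axis i (1 :: real)) UNIV Basis"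
    by (auto simp: bij_betw_def inj_def axis_eq_axis Basis_vec_def)
  from prod.reindex_bij_betw[OF this, of "\<lambda>b. v \<bullet> b"] show ?thesis
    by (simp add: cart_eq_inner_axis)
qed

text \<open>Lebesgue measure is determined by its values on boxes, and renumbering only permutes the
  side lengths of a box.\<close>

lemma lborel_reindex:
  fixes f :: "'m::finite \<Rightarrow> 'n::finite"
  assumes "bij f"
  shows "distr lborel borel (reindex f) = lborel"
proof (rule lborel_eqI[symmetric])
  fix l u :: "real ^ 'm"
  assume "\<And>b. b \<in> Basis \<Longrightarrow> l \<bullet> b \<le> u \<bullet> b"
  then have le: "l $ i \<le> u $ i" for i by (simp add: cart_eq_inner_axis axis_in_Basis_iff)
  have f: "f (inv f x) = x" "inv f (f y) = y" for x y
    using assms by (simp_all add: bij_is_surj surj_f_inv_f bij_is_inj)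
  have "reindex f -` box l u = box (reindex (inv f) l) (reindex (inv f) u)"
    by (auto simp: mem_box_cart reindex_def) (metis f)+
  moreover have "(reindex (inv f) l) \<bullet> b \<le> (reindex (inv f) u) \<bullet> b" if "b \<in> Basis" for b
    using that le by (auto simp: Basis_vec_def reindex_def inner_axis)
  ultimately have "emeasure (distr lborel borel (reindex f)) (box l u)
      = (\<Prod>b\<in>Basis. (reindex (inv f) u - reindex (inv f) l) \<bullet> b)"
    by (simp add: emeasure_distr)
  also have "\<dots> = (\<Prod>k\<in>UNIV. (u - l) $ inv f k)"
    by (simp only: prod_Basis_vec) (simp add: reindex_def)
  also have "\<dots> = (\<Prod>i\<in>UNIV. (u - l) $ i)"
    by (subst prod.reindex_bij_betw[OF bij_imp_bij_inv[OF assms], symmetric]) simp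
  finally show "emeasure (distr lborel borel (reindex f)) (box l u) = (\<Prod>b\<in>Basis. (u - l) \<bullet> b)"
    by (simp only: prod_Basis_vec)
qed simp

text \<open>The map is conjugated by the renumbering \<open>P\<close> with inverse \<open>Q\<close>,
  which preserves Lebesgue measure and leaves the Jacobian determinant unchanged.\<close>

lemma nn_integral_change_of_variables:
  fixes g :: "real ^ 'n \<Rightarrow> real ^ 'n" and f :: "real ^ 'n \<Rightarrow> real"
  assumes S: "S \<in> sets borel" and der: "\<And>x. x \<in> S \<Longrightarrow> (g has_derivative g' x) (at x within S)"
    and inj: "inj_on g S" and nonneg: "\<And>y. f y \<ge> 0"
    and meas: "(\<lambda>y. indicator (g ` S) y * f y) \<in> borel_measurable borel"
      "(\<lambda>x. indicator S x * (\<bar>det (matrix (g' x))\<bar> * f (g x))) \<in> borel_measurable borel"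
  shows "(\<integral>\<^sup>+y\<in>g ` S. ennreal (f y) \<partial>lborel)
    = (\<integral>\<^sup>+x\<in>S. ennreal (\<bar>det (matrix (g' x))\<bar> * f (g x)) \<partial>lborel)"
proof -
  obtain e :: "'n index \<Rightarrow> 'n" where e: "bij e" using index_bij by blast
  define P where "P = reindex e"
  define Q where "Q = reindex (inv e)"
  have e_inv: "e (inv e x) = x" "inv e (e y) = y" for x y
    using e by (simp_all add: bij_is_surj surj_f_inv_f bij_is_inj)
  have PQ: "P (Q y) = y" and QP: "Q (P x) = x" for x y
    by (simp_all add: P_def Q_def reindex_def e_inv)
  have lin: "linear P" "linear Q" by (simp_all add: P_def Q_def linear_reindex)
  have [measurable]: "P \<in> borel_measurable borel" "Q \<in> borel_measurable borel"
    by (simp_all add: P_def Q_def)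
  have lborel_P: "distr lborel borel P = lborel" by (simp add: P_def lborel_reindex[OF e])
  have image: "P ` T = Q -` T" for T using PQ QP by (auto simp: image_iff) metis
  have transfer: "(\<integral>\<^sup>+y\<in>P ` T. ennreal (F (Q y)) \<partial>lborel) = (\<integral>\<^sup>+x\<in>T. ennreal (F x) \<partial>lborel)"
    if "(\<lambda>x. indicator T x * F x) \<in> borel_measurable borel" for F :: "real ^ 'n \<Rightarrow> real" and T
  proof -
    note [measurable] = that
    have "(\<integral>\<^sup>+y\<in>P ` T. ennreal (F (Q y)) \<partial>lborel)
        = (\<integral>\<^sup>+y. ennreal (indicator T (Q y) * F (Q y)) \<partial>distr lborel borel P)"
      unfolding lborel_P image by (intro nn_integral_cong) (simp split: split_indicator)
    also have "\<dots> = (\<integral>\<^sup>+x. ennreal (indicator T x * F x) \<partial>lborel)"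
      by (subst nn_integral_distr) (simp_all add: QP)
    also have "\<dots> = (\<integral>\<^sup>+x\<in>T. ennreal (F x) \<partial>lborel)"
      by (intro nn_integral_cong) (auto split: split_indicator)
    finally show ?thesis .
  qed
  let ?G = "P \<circ> g \<circ> Q" and ?G' = "\<lambda>y. P \<circ> g' (Q y) \<circ> Q"
  \<comment> \<open>Conjugation permutes rows and columns of the Jacobian matrix by the same
    bijection \<open>e\<close>.\<close>
  have det: "det (matrix (?G' y)) = det (matrix (g' (Q y)))" for y
  proof -
    have "Q (axis j 1) = axis (e j) 1" for j
      by (auto simp: Q_def reindex_def axis_def vec_eq_iff e_inv)
    then have "matrix (?G' y) = (\<chi> i j. matrix (g' (Q y)) $ e i $ e j)"
      by (simp add: matrix_def P_def reindex_def)
    then show ?thesis by (simp add: det_reindex[OF e])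
  qed
  have GS: "?G ` (P ` S) = P ` (g ` S)" by (simp add: image_image QP)
  have bl: "bounded_linear P" "bounded_linear Q"
    using lin by (simp_all add: linear_conv_bounded_linear)
  have "(\<integral>\<^sup>+y\<in>?G ` (P ` S). ennreal (f (Q y)) \<partial>lborel)
      = (\<integral>\<^sup>+x\<in>P ` S. ennreal (\<bar>det (matrix (?G' x))\<bar> * f (Q (?G x))) \<partial>lborel)"
  proof (rule nn_integral_change_of_variables_wellorder)
    show "P ` S \<in> sets borel"
      using measurable_sets[OF \<open>Q \<in> borel_measurable borel\<close> S] by (simp add: image)
    show "(?G has_derivative ?G' y) (at y within P ` S)" if "y \<in> P ` S" for y
    proof -
      have "(g has_derivative g' (Q y)) (at (Q y) within Q ` P ` S)"
        using der[of "Q y"] that by (auto simp: image_image QP)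
      from diff_chain_within[OF bounded_linear_imp_has_derivative[OF bl(2)] this]
      have "(g \<circ> Q has_derivative g' (Q y) \<circ> Q) (at y within P ` S)" .
      from diff_chain_within[OF this bounded_linear_imp_has_derivative[OF bl(1)]]
      show ?thesis by (simp add: o_assoc)
    qed
    show "inj_on ?G (P ` S)"
      using inj by (auto simp: inj_on_def QP) (metis QP)
    show "(\<lambda>y. indicator (?G ` (P ` S)) y * f (Q y)) \<in> borel_measurable borel"
      using measurable_compose[OF \<open>Q \<in> borel_measurable borel\<close> meas(1)]
      unfolding GS unfolding image by (simp add: indicator_def)
    show "(\<lambda>x. indicator (P ` S) x * (\<bar>det (matrix (?G' x))\<bar> * f (Q (?G x)))) \<in> borel_measurable borel"
      using measurable_compose[OF \<open>Q \<in> borel_measurable borel\<close> meas(2)]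
      unfolding det image by (simp add: indicator_def QP)
  qed (rule nonneg)
  also have "\<dots> = (\<integral>\<^sup>+x\<in>P ` S. ennreal (\<bar>det (matrix (g' (Q x)))\<bar> * f (g (Q x))) \<partial>lborel)"
    unfolding det by (simp add: QP)
  also have "\<dots> = (\<integral>\<^sup>+x\<in>S. ennreal (\<bar>det (matrix (g' x))\<bar> * f (g x)) \<partial>lborel)"
    by (rule transfer[OF meas(2)])
  finally show ?thesis
    unfolding GS transfer[OF meas(1)] .
qed

subsection \<open>The Riemannian volume measure\<close>

lemma exists_sum_measure:
  fixes M :: "nat \<Rightarrow> 'a measure"
  assumes "\<And>n. sets (M n) = sets N"
  shows "\<exists>\<mu>. sets \<mu> = sets N \<and> (\<forall>S\<in>sets N. emeasure \<mu> S = (\<Sum>n. emeasure (M n) S))"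
proof (intro exI conjI ballI)
  let ?\<mu> = "measure_of (space N) (sets N) (\<lambda>S. \<Sum>n. emeasure (M n) S)"
  show "sets ?\<mu> = sets N" by simp
  fix S assume S: "S \<in> sets N"
  show "emeasure ?\<mu> S = (\<Sum>n. emeasure (M n) S)"
  proof (rule emeasure_measure_of)
    show "countably_additive (sets ?\<mu>) (\<lambda>S. \<Sum>n. emeasure (M n) S)"
    proof (rule countably_additiveI)
      fix T :: "nat \<Rightarrow> 'a set"
      assume T: "range T \<subseteq> sets ?\<mu>" "disjoint_family T"
      \<comment> \<open>Exchanging the two series is Tonelli's theorem with the counting measure as
        one factor.\<close>
      have "(\<Sum>i. \<Sum>n. emeasure (M n) (T i)) = (\<Sum>n. \<Sum>i. emeasure (M n) (T i))"
        using nn_integral_suminf[of "\<lambda>i n. emeasure (M n) (T i)" "count_space UNIV"]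
        by (simp add: nn_integral_count_space_nat)
      also have "\<dots> = (\<Sum>n. emeasure (M n) (\<Union>i. T i))"
        using T assms by (intro suminf_cong suminf_emeasure) auto
      finally show "(\<Sum>i. \<Sum>n. emeasure (M n) (T i)) = (\<Sum>n. emeasure (M n) (\<Union>i. T i))" .
    qed
  qed (use S sets.space_closed in \<open>auto simp: positive_def\<close>)
qed

context smooth_manifold
begin

text \<open>The indicator is essential: outside \<open>crange c\<close> the Gram matrix has no
  geometric meaning, and \<open>cinv c\<close> is a default value that must receive no mass when the
  density is pushed forward.\<close>

definition chart_density :: "('m, 'n) metric \<Rightarrow> ('m, 'n) chart \<Rightarrow> real ^ 'n \<Rightarrow> real" where
  "chart_density g c y = indicator (crange c) y * sqrt (det (gram A g c y))"

definition chart_measure :: "('m, 'n) metric \<Rightarrow> ('m, 'n) chart \<Rightarrow> 'm measure" where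
  "chart_measure g c = distr (density lborel (\<lambda>y. ennreal (chart_density g c y))) borel (cinv c)"

lemma borel_measurable_cinv [measurable]:
  assumes "c \<in> A"
  shows "cinv c \<in> borel_measurable borel"
proof -
  \<comment> \<open>Off the range of the chart the choice in \<open>inv_into\<close> has no
    candidate and returns one fixed default. So \<open>cinv c\<close> is continuous on an open set
    and constant elsewhere.\<close>
  have "cinv c = (\<lambda>y. if y \<in> crange c then cinv c y else (SOME x. False))"
  proof
    fix y
    have "cinv c y = (SOME x. False)" if "y \<notin> crange c"
      unfolding cinv_def inv_into_def using that by (intro arg_cong[of _ _ Eps]) (auto simp: crange_def)
    then show "cinv c y = (if y \<in> crange c then cinv c y else (SOME x. False))" by simp
  qed
  also have "\<dots> \<in> borel_measurable borel"
    using assms by (intro borel_measurable_continuous_on_if) (auto simp: is_chart_simps)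
  finally show ?thesis .
qed

lemma chart_density_nonneg:
  assumes "riemannian_metric A g" "c \<in> A"
  shows "chart_density g c y \<ge> 0"
  using det_gram_pos[OF assms, of y] by (auto simp: chart_density_def indicator_def intro: less_imp_le)

lemma borel_measurable_chart_density:
  assumes "riemannian_metric A g" "c \<in> A"
  shows "chart_density g c \<in> borel_measurable borel"
proof -
  have "continuous_on (crange c) (\<lambda>y. sqrt (det (gram A g c y)))"
    by (intro continuous_on_real_sqrt smooth_on_continuous_on smooth_on_det_gram assms)
  then have "(\<lambda>y. indicator (crange c) y *\<^sub>R sqrt (det (gram A g c y))) \<in> borel_measurable borel"
    using assms(2) by (intro borel_measurable_continuous_on_indicator) (auto simp: is_chart_simps)
  then show ?thesis by (simp add: chart_density_def[abs_def])
qed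

lemma sets_chart_measure [measurable_cong, simp]: "sets (chart_measure g c) = sets borel"
  by (simp add: chart_measure_def)

lemma nn_integral_chart_measure:
  assumes g: "riemannian_metric A g" and c: "c \<in> A" and F: "F \<in> borel_measurable borel"
  shows "(\<integral>\<^sup>+x. F x \<partial>chart_measure g c) = (\<integral>\<^sup>+y. ennreal (chart_density g c y) * F (cinv c y) \<partial>lborel)"
proof -
  note [measurable] = borel_measurable_chart_density[OF g c] borel_measurable_cinv[OF c] F
  show ?thesis
    by (simp add: chart_measure_def nn_integral_distr nn_integral_density)
qed

lemma chart_image_measurable:
  assumes "c \<in> A" "S \<in> sets borel" "S \<subseteq> cdom c"
  shows "coord c ` S \<in> sets borel"
  using measurable_sets[OF borel_measurable_cinv[OF assms(1)] assms(2)] assms(1)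
  by (auto simp: chart_image_eq[OF chart[OF assms(1)] assms(3)] is_chart_simps)

lemma emeasure_chart_measure:
  assumes g: "riemannian_metric A g" and c: "c \<in> A" and S: "S \<in> sets borel" "S \<subseteq> cdom c"
  shows "emeasure (chart_measure g c) S = (\<integral>\<^sup>+y\<in>coord c ` S. ennreal (chart_density g c y) \<partial>lborel)"
    and "emeasure (chart_measure g c) S = (\<integral>\<^sup>+y\<in>coord c ` S. ennreal (sqrt (det (gram A g c y))) \<partial>lborel)"
proof -
  have "emeasure (chart_measure g c) S = (\<integral>\<^sup>+x. indicator S x \<partial>chart_measure g c)"
    using S by simp
  also have "\<dots> = (\<integral>\<^sup>+y. ennreal (chart_density g c y) * indicator S (cinv c y) \<partial>lborel)"
    using S by (intro nn_integral_chart_measure g c) simp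
  also have "\<dots> = (\<integral>\<^sup>+y\<in>coord c ` S. ennreal (chart_density g c y) \<partial>lborel)"
    unfolding chart_image_eq[OF chart[OF c] S(2)]
    by (intro nn_integral_cong) (auto simp: chart_density_def split: split_indicator)
  finally show 1: "emeasure (chart_measure g c) S = (\<integral>\<^sup>+y\<in>coord c ` S. ennreal (chart_density g c y) \<partial>lborel)" .
  also have "\<dots> = (\<integral>\<^sup>+y\<in>coord c ` S. ennreal (sqrt (det (gram A g c y))) \<partial>lborel)"
    unfolding chart_image_eq[OF chart[OF c] S(2)]
    by (intro nn_integral_cong) (auto simp: chart_density_def split: split_indicator)
  finally show "emeasure (chart_measure g c) S = (\<integral>\<^sup>+y\<in>coord c ` S. ennreal (sqrt (det (gram A g c y))) \<partial>lborel)" .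
qed

text \<open>On overlaps the two chart measures agree by change of variables along the transition
  map. This is the compatibility that permits gluing.\<close>

lemma emeasure_chart_measure_eq:
  assumes g: "riemannian_metric A g" and c: "c \<in> A" "c' \<in> A"
    and S: "S \<in> sets borel" "S \<subseteq> cdom c" "S \<subseteq> cdom c'"
  shows "emeasure (chart_measure g c) S = emeasure (chart_measure g c') S"
proof -
  let ?\<tau> = "coord c' \<circ> cinv c" and ?T = "coord c ` S"
  let ?D = "\<lambda>y. transition_deriv c c' (cinv c y)"
  have cc: "cinv c (coord c x) = x" "cinv c' (coord c' x) = x" "coord c x \<in> crange c" "coord c' x \<in> crange c'"
    if "x \<in> S" for x
    using that S c by (auto simp: is_chart_simps subset_iff)
  have image: "?\<tau> ` ?T = coord c' ` S" using cc by (auto simp: image_image)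
  have T: "?T \<in> sets borel" "coord c' ` S \<in> sets borel"
    using chart_image_measurable c S by auto
  \<comment> \<open>Besides identifying the integrand, this equation yields its measurability
    without a separate argument for the Jacobian.\<close>
  have density: "indicator ?T y * (\<bar>det (matrix (?D y))\<bar> * chart_density g c' (?\<tau> y))
      = indicator ?T y * chart_density g c y" for y
  proof (cases "y \<in> ?T")
    case True
    then obtain x where x: "x \<in> S" "y = coord c x" by auto
    then show ?thesis
      using sqrt_det_gram_transition[OF g c subsetD[OF S(2) x(1)] subsetD[OF S(3) x(1)]] True
      by (auto simp: chart_density_def cc)
  qed simp
  note [measurable] = borel_measurable_chart_density[OF g c(1)] borel_measurable_chart_density[OF g c(2)] T
  have "(\<integral>\<^sup>+y\<in>?\<tau> ` ?T. ennreal (chart_density g c' y) \<partial>lborel)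
      = (\<integral>\<^sup>+y\<in>?T. ennreal (\<bar>det (matrix (?D y))\<bar> * chart_density g c' (?\<tau> y)) \<partial>lborel)"
  proof (rule nn_integral_change_of_variables)
    show "(?\<tau> has_derivative ?D y) (at y within ?T)" if y: "y \<in> ?T" for y
    proof -
      from y obtain x where x: "x \<in> S" "y = coord c x" by (rule imageE)
      have "(?\<tau> has_derivative transition_deriv c c' x) (at (coord c x))"
        by (rule has_derivative_transition[OF c subsetD[OF S(2) x(1)] subsetD[OF S(3) x(1)]])
      then show ?thesis
        by (simp only: x(2) cc(1)[OF x(1)] has_derivative_at_withinI)
    qed
    show "inj_on ?\<tau> ?T"
      using cc by (intro inj_onI) (auto, metis)
    show "(\<lambda>y. indicator (?\<tau> ` ?T) y * chart_density g c' y) \<in> borel_measurable borel"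
      unfolding image by measurable
    show "(\<lambda>y. indicator ?T y * (\<bar>det (matrix (?D y))\<bar> * chart_density g c' (?\<tau> y))) \<in> borel_measurable borel"
      unfolding density by measurable
  qed (use T chart_density_nonneg[OF g c(2)] in auto)
  also have "\<dots> = (\<integral>\<^sup>+y\<in>?T. ennreal (chart_density g c y) \<partial>lborel)"
    using density by (intro nn_integral_cong) (auto split: split_indicator simp: indicator_def)
  finally show ?thesis
    using emeasure_chart_measure(1)[OF g c(1) S(1,2)] emeasure_chart_measure(1)[OF g c(2) S(1,3)]
    by (simp only: image)
qed

section \<open>Gluing the chart measures\<close>

lemma countable_chart_cover:
  "\<exists>C :: nat \<Rightarrow> ('m, 'n) chart. (\<forall>n. C n \<in> A) \<and> (\<Union>n. cdom (C n)) = UNIV"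
proof -
  have "\<And>U. U \<in> cdom ` A \<Longrightarrow> open U" using is_chart_simps(1)[OF chart] by blast
  then obtain F where F: "F \<subseteq> cdom ` A" "countable F" "\<Union>F = \<Union>(cdom ` A)"
    using Lindelof by metis
  obtain B where B: "B \<subseteq> A" "countable B" "F = cdom ` B"
    using F(1,2) countable_subset_image by metis
  have U: "\<Union>(cdom ` B) = UNIV" using B F(3) atlas by (simp add: smooth_atlas_def)
  \<comment> \<open>\<open>from_nat_into\<close> enumerates nonempty sets only, with repetitions if
    they are finite; a type is never empty, so some chart is present.\<close>
  then have "B \<noteq> {}" by auto
  then have "from_nat_into B n \<in> A" and "range (from_nat_into B) = B" for n
    using B(1,2) from_nat_into[of B n] by (auto simp: range_from_nat_into)
  moreover from this(2) have "(\<Union>n. cdom (from_nat_into B n)) = UNIV"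
    using U by (metis image_image)
  ultimately show ?thesis by (intro exI[of _ "from_nat_into B"]) simp
qed

lemma countable_chart_partition:
  "\<exists>(C :: nat \<Rightarrow> ('m, 'n) chart) D. (\<forall>n. C n \<in> A \<and> D n \<in> sets borel \<and> D n \<subseteq> cdom (C n)) \<and>
     disjoint_family D \<and> (\<Union>n. D n) = UNIV"
proof -
  obtain C :: "nat \<Rightarrow> ('m, 'n) chart" where C: "(\<forall>n. C n \<in> A) \<and> (\<Union>n. cdom (C n)) = UNIV"
    using countable_chart_cover by blast
  have "range (disjointed (\<lambda>n. cdom (C n))) \<subseteq> sets borel"
    using C by (intro sets.range_disjointed_sets) (auto intro!: borel_open is_chart_simps(1))
  then show ?thesis
    using C UN_disjointed_eq[of "\<lambda>n. cdom (C n)"] disjoint_family_disjointed[of "\<lambda>n. cdom (C n)"]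
      disjointed_subset[of "\<lambda>n. cdom (C n)"]
    by (intro exI[of _ C] exI[of _ "disjointed (\<lambda>n. cdom (C n))"]) (simp add: image_subset_iff)
qed

lemma emeasure_partition:
  assumes "sets \<rho> = sets borel" "S \<in> sets borel" "\<And>n :: nat. D n \<in> sets borel"
    "disjoint_family D" "(\<Union>n. D n) = UNIV"
  shows "emeasure \<rho> S = (\<Sum>n. emeasure \<rho> (S \<inter> D n))"
proof -
  have "disjoint_family (\<lambda>n. S \<inter> D n)"
    using assms(4) unfolding disjoint_family_on_def by blast
  then have "(\<Sum>n. emeasure \<rho> (S \<inter> D n)) = emeasure \<rho> (\<Union>n. S \<inter> D n)"
    using assms(1-3) by (intro suminf_emeasure) auto
  also have "(\<Union>n. S \<inter> D n) = S" using assms(5) by blast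
  finally show ?thesis by simp
qed

text \<open>The property in the definite description of \<open>riemannian_vol\<close>, named so that
  its existence and uniqueness can be established.\<close>

definition is_volume :: "('m, 'n) metric \<Rightarrow> 'm measure \<Rightarrow> bool" where
  "is_volume g \<mu> \<longleftrightarrow> sets \<mu> = sets borel \<and>
     (\<forall>c\<in>A. \<forall>S\<in>sets borel. S \<subseteq> cdom c \<longrightarrow>
        emeasure \<mu> S = (\<integral>\<^sup>+y\<in>coord c ` S. ennreal (sqrt (det (gram A g c y))) \<partial>lborel))"

lemma is_volumeD:
  "is_volume g \<mu> \<Longrightarrow> c \<in> A \<Longrightarrow> S \<in> sets borel \<Longrightarrow> S \<subseteq> cdom c \<Longrightarrow>
    emeasure \<mu> S = (\<integral>\<^sup>+y\<in>coord c ` S. ennreal (sqrt (det (gram A g c y))) \<partial>lborel)"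
  by (simp add: is_volume_def)

text \<open>Every Borel set splits into countably many pieces, each inside one chart, where the
  value of the measure is prescribed.\<close>

lemma is_volume_unique:
  assumes "is_volume g \<mu>" "is_volume g \<nu>"
  shows "\<mu> = \<nu>"
proof (rule measure_eqI)
  show "sets \<mu> = sets \<nu>" using assms by (simp add: is_volume_def)
  fix S assume "S \<in> sets \<mu>"
  then have S: "S \<in> sets borel" using assms by (simp add: is_volume_def)
  obtain C :: "nat \<Rightarrow> ('m, 'n) chart" and D where
    "(\<forall>n. C n \<in> A \<and> D n \<in> sets borel \<and> D n \<subseteq> cdom (C n)) \<and> disjoint_family D \<and> (\<Union>n. D n) = UNIV"
    using countable_chart_partition by metis
  then have C: "\<And>n. C n \<in> A" and D: "\<And>n. D n \<in> sets borel" "\<And>n. D n \<subseteq> cdom (C n)"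
    "disjoint_family D" "(\<Union>n. D n) = UNIV" by simp_all
  have "emeasure \<rho> S = (\<Sum>n. emeasure \<rho> (S \<inter> D n))" if "sets \<rho> = sets borel" for \<rho> :: "'m measure"
    using that S D(1,3,4) by (rule emeasure_partition)
  moreover have "emeasure \<mu> (S \<inter> D n) = emeasure \<nu> (S \<inter> D n)" for n
  proof -
    have S': "S \<inter> D n \<in> sets borel" "S \<inter> D n \<subseteq> cdom (C n)" using S D(1,2) by auto
    show ?thesis
      by (simp only: is_volumeD[OF assms(1) C S'] is_volumeD[OF assms(2) C S'])
  qed
  ultimately show "emeasure \<mu> S = emeasure \<nu> S" using assms by (simp add: is_volume_def)
qed

text \<open>The measure is the sum of the chart measures cut down to the pieces of a partition. For
  a set inside an arbitrary chart \<open>c\<close>, agreement on overlaps replaces the chart of each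
  piece by \<open>c\<close>, and the pieces add up again.\<close>

lemma is_volume_exists:
  assumes g: "riemannian_metric A g"
  shows "\<exists>\<mu>. is_volume g \<mu>"
proof -
  obtain C :: "nat \<Rightarrow> ('m, 'n) chart" and D where
    "(\<forall>n. C n \<in> A \<and> D n \<in> sets borel \<and> D n \<subseteq> cdom (C n)) \<and> disjoint_family D \<and> (\<Union>n. D n) = UNIV"
    using countable_chart_partition by metis
  then have C: "\<And>n. C n \<in> A" and D: "\<And>n. D n \<in> sets borel" "\<And>n. D n \<subseteq> cdom (C n)"
    "disjoint_family D" "(\<Union>n. D n) = UNIV" by simp_all
  let ?M = "\<lambda>n. density (chart_measure g (C n)) (indicator (D n))"
  obtain \<mu> where \<mu>: "sets \<mu> = sets borel" "\<And>S. S \<in> sets borel \<Longrightarrow> emeasure \<mu> S = (\<Sum>n. emeasure (?M n) S)"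
    using exists_sum_measure[of ?M borel] by auto
  have "is_volume g \<mu>"
    unfolding is_volume_def
  proof (intro conjI ballI impI)
    fix c S assume c: "c \<in> A" and S: "S \<in> sets borel" "S \<subseteq> cdom c"
    have "emeasure (?M n) S = emeasure (chart_measure g c) (S \<inter> D n)" for n
    proof -
      have "emeasure (?M n) S = emeasure (chart_measure g (C n)) (D n \<inter> S)"
        using S D(1) by (simp add: emeasure_density nn_integral_indicator flip: indicator_inter_arith)
      also have "\<dots> = emeasure (chart_measure g c) (D n \<inter> S)"
        using S D(1,2) by (intro emeasure_chart_measure_eq g c C) auto
      finally show ?thesis by (simp add: Int_commute)
    qed
    then have "emeasure \<mu> S = (\<Sum>n. emeasure (chart_measure g c) (S \<inter> D n))"
      using \<mu>(2)[OF S(1)] by simp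
    also have "\<dots> = emeasure (chart_measure g c) S"
      by (rule emeasure_partition[OF sets_chart_measure S(1) D(1,3,4), symmetric])
    finally show "emeasure \<mu> S = (\<integral>\<^sup>+y\<in>coord c ` S. ennreal (sqrt (det (gram A g c y))) \<partial>lborel)"
      using emeasure_chart_measure(2)[OF g c S] by simp
  qed (rule \<mu>(1))
  then show ?thesis ..
qed

lemma is_volume_riemannian_vol:
  assumes "riemannian_metric A g"
  shows "is_volume g (riemannian_vol A g)"
proof -
  have "\<exists>!\<mu>. is_volume g \<mu>"
    using is_volume_exists[OF assms] is_volume_unique by blast
  moreover have "riemannian_vol A g = (THE \<mu>. is_volume g \<mu>)"
    by (simp add: riemannian_vol_def is_volume_def)
  ultimately show ?thesis by (simp add: theI')
qed

section \<open>Integration in charts and the density between two volumes\<close>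

lemma sets_riemannian_vol:
  "riemannian_metric A g \<Longrightarrow> sets (riemannian_vol A g) = sets borel"
  using is_volume_riemannian_vol by (simp add: is_volume_def)

lemma density_riemannian_vol_chart:
  assumes g: "riemannian_metric A g" and c: "c \<in> A"
  shows "density (riemannian_vol A g) (indicator (cdom c)) = chart_measure g c"
proof (rule measure_eqI)
  note sets_riemannian_vol[OF g, simp, measurable_cong]
  have d: "cdom c \<in> sets borel" using c by (simp add: is_chart_simps)
  show "sets (density (riemannian_vol A g) (indicator (cdom c))) = sets (chart_measure g c)" by simp
  fix S assume "S \<in> sets (density (riemannian_vol A g) (indicator (cdom c)))"
  then have S: "S \<in> sets borel" by simp
  have "emeasure (density (riemannian_vol A g) (indicator (cdom c))) S = emeasure (riemannian_vol A g) (cdom c \<inter> S)"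
    using S d by (simp add: emeasure_density nn_integral_indicator flip: indicator_inter_arith)
  also have "\<dots> = emeasure (chart_measure g c) (cdom c \<inter> S)"
    using is_volume_riemannian_vol[OF g] emeasure_chart_measure(2)[OF g c, of "cdom c \<inter> S"] S d c
    by (simp add: is_volume_def)
  also have "\<dots> = (\<integral>\<^sup>+x. indicator (cdom c \<inter> S) x \<partial>chart_measure g c)"
    using S d by simp
  \<comment> \<open>\<open>cinv c\<close> maps \<open>crange c\<close> into \<open>cdom c\<close>,
    so the chart measure has no mass outside \<open>cdom c\<close>.\<close>
  also have "\<dots> = (\<integral>\<^sup>+x. indicator S x \<partial>chart_measure g c)"
    using S d c is_chart_simps(8)[OF chart[OF c]]
    by (subst (1 2) nn_integral_chart_measure[OF g c])
      (auto intro!: nn_integral_cong simp: chart_density_def split: split_indicator)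
  finally show "emeasure (density (riemannian_vol A g) (indicator (cdom c))) S = emeasure (chart_measure g c) S"
    using S by simp
qed

text \<open>By uniqueness it is enough to check the chart formula for the measure on the right, and
  there \<open>vol_ratio\<close> turns one root determinant into the other.\<close>

lemma riemannian_vol_density:
  assumes g: "riemannian_metric A g" "riemannian_metric A g'"
  shows "riemannian_vol A g' = density (riemannian_vol A g) (\<lambda>x. ennreal (vol_ratio g g' x))"
proof (rule is_volume_unique[OF is_volume_riemannian_vol[OF g(2)]])
  note sets_riemannian_vol[OF g(1), simp, measurable_cong]
  have r [measurable]: "vol_ratio g g' \<in> borel_measurable borel"
    by (intro borel_measurable_continuous_onI smooth_fun_continuous[OF atlas] smooth_fun_vol_ratio g)
  show "is_volume g' (density (riemannian_vol A g) (\<lambda>x. ennreal (vol_ratio g g' x)))"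
    unfolding is_volume_def
  proof (intro conjI ballI impI)
    fix c S assume c: "c \<in> A" and S [measurable]: "S \<in> sets borel" and Sc: "S \<subseteq> cdom c"
    have [measurable]: "cdom c \<in> sets borel" using c by (simp add: is_chart_simps)
    let ?F = "\<lambda>x. ennreal (vol_ratio g g' x) * indicator S x"
    have "emeasure (density (riemannian_vol A g) (\<lambda>x. ennreal (vol_ratio g g' x))) S
        = (\<integral>\<^sup>+x. ?F x \<partial>riemannian_vol A g)"
      by (simp add: emeasure_density)
    also have "\<dots> = (\<integral>\<^sup>+x. indicator (cdom c) x * ?F x \<partial>riemannian_vol A g)"
      using Sc by (intro nn_integral_cong) (auto split: split_indicator)
    also have "\<dots> = (\<integral>\<^sup>+x. ?F x \<partial>chart_measure g c)"
      unfolding density_riemannian_vol_chart[OF g(1) c, symmetric]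
      by (subst nn_integral_density) simp_all
    also have "\<dots> = (\<integral>\<^sup>+y. ennreal (chart_density g c y) * ?F (cinv c y) \<partial>lborel)"
      by (intro nn_integral_chart_measure g c) simp
    also have "\<dots> = (\<integral>\<^sup>+y\<in>coord c ` S. ennreal (sqrt (det (gram A g' c y))) \<partial>lborel)"
    proof (intro nn_integral_cong)
      fix y :: "real ^ 'n"
      show "ennreal (chart_density g c y) * ?F (cinv c y)
          = ennreal (sqrt (det (gram A g' c y))) * indicator (coord c ` S) y"
      proof (cases "y \<in> crange c")
        case True
        have "ennreal (vol_ratio g g' (cinv c y)) * ennreal (sqrt (det (gram A g c y)))
            = ennreal (sqrt (det (gram A g' c y)))"
          using vol_ratio_gram[OF g c True] vol_ratio_pos[OF g, of "cinv c y"] det_gram_pos[OF g(1) c True]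
          by (simp add: ennreal_mult[symmetric])
        then show ?thesis
          using True by (auto simp: chart_density_def chart_image_eq[OF chart[OF c] Sc] mult.commute
              split: split_indicator)
      next
        case False
        then show ?thesis by (simp add: chart_density_def chart_image_eq[OF chart[OF c] Sc])
      qed
    qed
    finally show "emeasure (density (riemannian_vol A g) (\<lambda>x. ennreal (vol_ratio g g' x))) S
        = (\<integral>\<^sup>+y\<in>coord c ` S. ennreal (sqrt (det (gram A g' c y))) \<partial>lborel)" .
  qed simp
qed

end

subsection \<open>Comparison of the variations\<close>

text \<open>Valid for arbitrary \<open>f\<close>: dividing by the positive \<open>r\<close> shows
  that \<open>f\<close> and its product with \<open>r\<close> are measurable together, and in the
  non-measurable case both Bochner integrals have the default value 0. Thus variations can be
  compared for every function.\<close>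

lemma integral_density_pos:
  fixes f :: "'a \<Rightarrow> 'b::{banach, second_countable_topology}" and r :: "'a \<Rightarrow> real"
  assumes [measurable]: "r \<in> borel_measurable M" and pos: "\<And>x. r x > 0"
  shows "(\<integral>x. f x \<partial>density M r) = (\<integral>x. r x *\<^sub>R f x \<partial>M)"
proof (cases "f \<in> borel_measurable M")
  case True
  then show ?thesis using pos by (intro integral_density) (auto intro: less_imp_le)
next
  case False
  have "(\<lambda>x. r x *\<^sub>R f x) \<notin> borel_measurable M"
  proof
    assume "(\<lambda>x. r x *\<^sub>R f x) \<in> borel_measurable M"
    then have "(\<lambda>x. inverse (r x) *\<^sub>R (r x *\<^sub>R f x)) \<in> borel_measurable M"
      by (rule borel_measurable_scaleR[OF borel_measurable_inverse[OF assms(1)]])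
    moreover have "inverse (r x) *\<^sub>R (r x *\<^sub>R f x) = f x" for x
      using pos[of x] by simp
    ultimately show False using False by (simp only:)
  qed
  then show ?thesis
    using False borel_measurable_integrable[of "density M r" f]
      borel_measurable_integrable[of M "\<lambda>x. r x *\<^sub>R f x"]
    by (metis measurable_density_eq1 not_integrable_integral_eq)
qed

context smooth_manifold
begin

lemma borel_measurable_vol_ratio:
  assumes "riemannian_metric A g" "riemannian_metric A g'"
  shows "vol_ratio g g' \<in> borel_measurable (riemannian_vol A g)"
  unfolding measurable_cong_sets[OF sets_riemannian_vol[OF assms(1)] refl]
  by (intro borel_measurable_continuous_onI smooth_fun_continuous[OF atlas] smooth_fun_vol_ratio assms)

lemma integral_riemannian_vol:
  fixes f :: "'m \<Rightarrow> 'b::{banach, second_countable_topology}"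
  assumes g: "riemannian_metric A g" "riemannian_metric A g'"
  shows "(\<integral>x. f x \<partial>riemannian_vol A g') = (\<integral>x. vol_ratio g g' x *\<^sub>R f x \<partial>riemannian_vol A g)"
  unfolding riemannian_vol_density[OF g]
  by (intro integral_density_pos borel_measurable_vol_ratio vol_ratio_pos g)

lemma smooth_fun_cmult:
  fixes r :: "'m \<Rightarrow> real"
  shows "smooth_fun A r \<Longrightarrow> smooth_fun A (\<lambda>x. s * r x)"
  by (auto simp: smooth_fun_def o_def is_chart_simps intro!: smooth_on_mult smooth_on_const)

text \<open>Multiplying the codifferential with the volume ratio turns the \<open>g'\<close>-pairing into the
  \<open>g\<close>-pairing, so no existence or uniqueness of codifferentials is needed.\<close>

lemma is_codiff_transfer_form:
  assumes g: "riemannian_metric A g" "riemannian_metric A g'"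
    and \<alpha>: "test_form A \<alpha>" and h: "is_codiff A g' \<alpha> h"
  shows "is_codiff A g (transfer_form g g' (\<lambda>x. s * vol_ratio g g' x) \<alpha>) (\<lambda>x. (s * vol_ratio g g' x) *\<^sub>R h x)"
  unfolding is_codiff_def
proof (intro conjI allI impI)
  let ?r = "vol_ratio g g'"
  show "smooth_fun A (\<lambda>x. (s * ?r x) *\<^sub>R h x)"
    using h smooth_fun_vol_ratio[OF g] by (intro smooth_fun_scaleR smooth_fun_cmult) (auto simp: is_codiff_def)
  fix \<phi> assume \<phi>: "test_fun A \<phi>"
  have "(\<integral>x. cnj (\<phi> x) * (s * ?r x) *\<^sub>R h x \<partial>riemannian_vol A g)
      = s *\<^sub>R (\<integral>x. ?r x *\<^sub>R (cnj (\<phi> x) * h x) \<partial>riemannian_vol A g)"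
    by (simp flip: integral_scaleR_right)
  also have "\<dots> = s *\<^sub>R (\<integral>x. cnj (\<phi> x) * h x \<partial>riemannian_vol A g')"
    by (simp only: integral_riemannian_vol[OF g])
  also have "\<dots> = s *\<^sub>R (\<integral>x. cotangent_inner g' x (exterior_deriv A \<phi> x) (\<alpha> x) \<partial>riemannian_vol A g')"
    using h \<phi> by (simp add: is_codiff_def)
  also have "\<dots> = s *\<^sub>R (\<integral>x. ?r x *\<^sub>R cotangent_inner g' x (exterior_deriv A \<phi> x) (\<alpha> x) \<partial>riemannian_vol A g)"
    by (simp only: integral_riemannian_vol[OF g])
  also have "\<dots> = (\<integral>x. (s * ?r x) *\<^sub>R cotangent_inner g' x (exterior_deriv A \<phi> x) (\<alpha> x) \<partial>riemannian_vol A g)"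
    by (simp flip: integral_scaleR_right)
  also have "\<dots> = (\<integral>x. cotangent_inner g x (exterior_deriv A \<phi> x)
      (transfer_form g g' (\<lambda>x. s * ?r x) \<alpha> x) \<partial>riemannian_vol A g)"
  proof (intro Bochner_Integration.integral_cong refl)
    fix x
    have "linear (\<alpha> x)" using \<alpha> by (simp add: test_form_def)
    then have "cotangent_inner g x (exterior_deriv A \<phi> x) (\<alpha> x \<circ> form_map (g' x) (g x))
        = cotangent_inner g' x (exterior_deriv A \<phi> x) (\<alpha> x)"
      by (intro cotangent_inner_form_map riemannian_metric_inner_form g)
    then show "(s * ?r x) *\<^sub>R cotangent_inner g' x (exterior_deriv A \<phi> x) (\<alpha> x)
        = cotangent_inner g x (exterior_deriv A \<phi> x) (transfer_form g g' (\<lambda>x. s * ?r x) \<alpha> x)"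
      by (simp only: transfer_form_def cotangent_inner_cmult o_def)
  qed
  finally show "(\<integral>x. cnj (\<phi> x) * (s * ?r x) *\<^sub>R h x \<partial>riemannian_vol A g)
      = (\<integral>x. cotangent_inner g x (exterior_deriv A \<phi> x)
          (transfer_form g g' (\<lambda>x. s * ?r x) \<alpha> x) \<partial>riemannian_vol A g)" .
qed

text \<open>Each competitor for \<open>g'\<close> yields one for \<open>g\<close> with a
  proportional pairing. The factor \<open>K\<close> comes from the volume ratio and \<open>C\<close>
  from transferring covectors; working in \<open>ennreal\<close> includes infinite
  variation.\<close>

lemma variation_le:
  assumes g: "riemannian_metric A g" "riemannian_metric A g'"
    and K: "\<And>x. vol_ratio g g' x \<le> K" and C: "C > 0" "\<And>x v. g x v v \<le> C\<^sup>2 * g' x v v"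
  shows "variation A g' f \<le> ennreal (K * C) * variation A g f"
  unfolding variation_def[of A g']
proof (rule Sup_least, clarify)
  fix \<alpha> h
  assume \<alpha>: "test_form A \<alpha>" "form_sup_norm g' \<alpha> \<le> 1" and h: "is_codiff A g' \<alpha> h"
  let ?r = "vol_ratio g g'"
  have Kpos: "K > 0" using K vol_ratio_pos[OF g] less_le_trans by blast
  \<comment> \<open>Normalization: the unscaled transferred form has \<open>g\<close>-norm at most
    \<open>K * C\<close>, so this factor makes it admissible in the supremum for
    \<open>g\<close>.\<close>
  define s where "s = 1 / (K * C)"
  have s: "s > 0" "s * (K * C) = 1" using Kpos C(1) by (simp_all add: s_def)
  let ?\<beta> = "transfer_form g g' (\<lambda>x. s * ?r x) \<alpha>" and ?h = "\<lambda>x. (s * ?r x) *\<^sub>R h x"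
  have "cotangent_norm g x (?\<beta> x) \<le> 1" for x
  proof -
    have lin: "linear (\<alpha> x)" using \<alpha>(1) by (simp add: test_form_def)
    have "ennreal (cotangent_norm g' x (\<alpha> x)) \<le> 1"
      using \<alpha>(2) unfolding form_sup_norm_def by (rule order_trans[OF SUP_upper[OF UNIV_I]])
    then have 1: "cotangent_norm g' x (\<alpha> x) \<le> 1" by simp
    have "cotangent_norm g x (?\<beta> x) = s * ?r x * cotangent_norm g x (\<alpha> x \<circ> form_map (g' x) (g x))"
      using s(1) less_imp_le[OF vol_ratio_pos[OF g, of x]]
      by (simp add: transfer_form_def o_def cotangent_norm_scaleR)
    also have "\<dots> \<le> s * ?r x * (C * cotangent_norm g' x (\<alpha> x))"
      using s(1) vol_ratio_pos[OF g, of x] C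
      by (intro mult_left_mono cotangent_norm_form_map_le riemannian_metric_inner_form g lin) auto
    also have "\<dots> \<le> s * ?r x * (C * 1)"
      using s(1) vol_ratio_pos[OF g, of x] C(1) 1 by (intro mult_left_mono) auto
    also have "\<dots> \<le> s * K * (C * 1)"
      using s(1) C(1) K[of x] by (intro mult_right_mono mult_left_mono) auto
    finally show ?thesis using s(2) by (simp add: mult.assoc)
  qed
  then have "form_sup_norm g ?\<beta> \<le> 1" by (auto simp: form_sup_norm_def intro!: SUP_least)
  moreover have "test_form A ?\<beta>"
    by (intro test_form_transfer_form g \<alpha> smooth_fun_cmult smooth_fun_vol_ratio)
  moreover have "is_codiff A g ?\<beta> ?h" by (rule is_codiff_transfer_form[OF g \<alpha>(1) h])
  ultimately have le: "ennreal (cmod (\<integral>x. cnj (f x) * ?h x \<partial>riemannian_vol A g)) \<le> variation A g f"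
    unfolding variation_def by (intro Sup_upper CollectI exI[of _ ?\<beta>] exI[of _ ?h] conjI refl)
  have "(\<integral>x. cnj (f x) * ?h x \<partial>riemannian_vol A g)
      = s *\<^sub>R (\<integral>x. ?r x *\<^sub>R (cnj (f x) * h x) \<partial>riemannian_vol A g)"
    by (simp flip: integral_scaleR_right)
  also have "\<dots> = s *\<^sub>R (\<integral>x. cnj (f x) * h x \<partial>riemannian_vol A g')"
    by (simp only: integral_riemannian_vol[OF g])
  finally have eq: "(\<integral>x. cnj (f x) * ?h x \<partial>riemannian_vol A g)
      = s *\<^sub>R (\<integral>x. cnj (f x) * h x \<partial>riemannian_vol A g')" .
  have "K * C * s = 1" using s(2) by (simp only: mult.commute)
  then have "cmod (\<integral>x. cnj (f x) * h x \<partial>riemannian_vol A g')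
      = K * C * cmod (\<integral>x. cnj (f x) * ?h x \<partial>riemannian_vol A g)"
    by (simp only: eq norm_scaleR abs_of_pos[OF s(1)] mult.assoc[symmetric] mult_1_left)
  then have "ennreal (cmod (\<integral>x. cnj (f x) * h x \<partial>riemannian_vol A g'))
      = ennreal (K * C) * ennreal (cmod (\<integral>x. cnj (f x) * ?h x \<partial>riemannian_vol A g))"
    using Kpos C(1) by (simp add: ennreal_mult)
  also have "\<dots> \<le> ennreal (K * C) * variation A g f" by (rule mult_left_mono[OF le]) simp
  finally show "ennreal (cmod (\<integral>x. cnj (f x) * h x \<partial>riemannian_vol A g')) \<le> ennreal (K * C) * variation A g f" .
qed

lemma BV_norm_le:
  assumes g: "riemannian_metric A g" "riemannian_metric A g'" and "quasi_isometric g g'"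
  shows "\<exists>D>0. \<forall>f\<in>BV A g. f \<in> BV A g' \<and> BV_norm A g' f \<le> ennreal D * BV_norm A g f"
proof -
  obtain C1 C2 where C: "C1 > 0" "C2 > 0" and
    le: "\<And>x v. C1 * tangent_norm g x v \<le> tangent_norm g' x v"
      "\<And>x v. tangent_norm g' x v \<le> C2 * tangent_norm g x v"
    using assms(3) unfolding quasi_isometric_def by blast
  have nonneg: "g x v v \<ge> 0" "g' x v v \<ge> 0" for x v
    using inner_form_nonneg riemannian_metric_inner_form g by blast+
  have sq: "(tangent_norm g x v)\<^sup>2 = g x v v" "(tangent_norm g' x v)\<^sup>2 = g' x v v" for x v
    using nonneg by (simp_all add: tangent_norm_def)
  have upper: "g' x v v \<le> C2\<^sup>2 * g x v v" for x v
    using power_mono[OF le(2)[of x v], of 2] nonneg(2)[of x v]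
    by (simp add: sq power_mult_distrib tangent_norm_def[of g'])
  have "C1\<^sup>2 * g x v v \<le> g' x v v" for x v
    using power_mono[OF le(1)[of x v], of 2] nonneg(1)[of x v] C(1)
    by (simp add: sq power_mult_distrib tangent_norm_def[of g])
  then have lower: "g x v v \<le> (1 / C1)\<^sup>2 * g' x v v" for x v
    using C(1) by (simp add: power_one_over field_simps)
  \<comment> \<open>\<open>vol_ratio\<close> is the root of a quotient of determinants, which
    \<open>det_form_matrix_le\<close> bounds through the squared upper constant.\<close>
  define K where "K = sqrt (fact CARD('n) * (C2\<^sup>2) ^ CARD('n))"
  have K: "K > 0" using C(2) by (simp add: K_def)
  have ratio: "vol_ratio g g' x \<le> K" for x
  proof -
    note inner = riemannian_metric_inner_form[OF g(1), of x] riemannian_metric_inner_form[OF g(2), of x]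
    show ?thesis
      using det_form_matrix_le[OF inner upper] det_form_matrix_pos[OF inner(1)]
      by (simp add: vol_ratio_def K_def divide_le_eq)
  qed
  \<comment> \<open>The L1 part needs the factor \<open>K\<close>, the variation
    \<open>K / C1\<close>; the maximum serves both summands of the BV norm.\<close>
  define D where "D = max K (K * (1 / C1))"
  have D: "D > 0" "ennreal K \<le> ennreal D" "ennreal (K * (1 / C1)) \<le> ennreal D"
    using K by (auto simp: D_def less_max_iff_disj intro!: ennreal_leI)
  have var: "variation A g' f \<le> ennreal D * variation A g f" for f
    using variation_le[OF g ratio _ lower, of f] C(1) mult_right_mono[OF D(3), of "variation A g f"]
    by (simp add: order_trans)
  show ?thesis
  proof (intro exI[of _ D] conjI ballI D(1))
    fix f assume f: "f \<in> BV A g"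
    have [measurable]: "f \<in> borel_measurable (riemannian_vol A g)"
      "vol_ratio g g' \<in> borel_measurable (riemannian_vol A g)"
      using f borel_measurable_vol_ratio[OF g] by (auto simp: BV_def)
    have "(\<integral>\<^sup>+x. ennreal (cmod (f x)) \<partial>riemannian_vol A g')
        = (\<integral>\<^sup>+x. ennreal (vol_ratio g g' x) * ennreal (cmod (f x)) \<partial>riemannian_vol A g)"
      unfolding riemannian_vol_density[OF g] by (simp add: nn_integral_density)
    also have "\<dots> \<le> (\<integral>\<^sup>+x. ennreal D * ennreal (cmod (f x)) \<partial>riemannian_vol A g)"
      using order_trans[OF ennreal_leI[OF ratio] D(2)] by (intro nn_integral_mono mult_right_mono) auto
    also have "\<dots> = ennreal D * (\<integral>\<^sup>+x. ennreal (cmod (f x)) \<partial>riemannian_vol A g)"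
      by (intro nn_integral_cmult) measurable
    finally have L1: "(\<integral>\<^sup>+x. ennreal (cmod (f x)) \<partial>riemannian_vol A g')
        \<le> ennreal D * (\<integral>\<^sup>+x. ennreal (cmod (f x)) \<partial>riemannian_vol A g)" .
    have fin: "(\<integral>\<^sup>+x. ennreal (cmod (f x)) \<partial>riemannian_vol A g) < \<infinity>" "variation A g f < \<infinity>"
      using f by (auto simp: BV_def integrable_iff_bounded)
    have "f \<in> borel_measurable (riemannian_vol A g')"
      unfolding riemannian_vol_density[OF g] by simp
    moreover have "(\<integral>\<^sup>+x. ennreal (cmod (f x)) \<partial>riemannian_vol A g') < \<infinity>"
      using fin(1) by (intro le_less_trans[OF L1]) (simp add: ennreal_mult_less_top)
    moreover have "variation A g' f < \<infinity>"
      using fin(2) by (intro le_less_trans[OF var]) (simp add: ennreal_mult_less_top)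
    ultimately show "f \<in> BV A g'" by (simp add: BV_def integrable_iff_bounded)
    show "BV_norm A g' f \<le> ennreal D * BV_norm A g f"
      unfolding BV_norm_def distrib_left by (rule add_mono[OF L1 var])
  qed
qed

end

lemma quasi_isometric_sym:
  assumes "quasi_isometric g g'"
  shows "quasi_isometric g' g"
proof -
  obtain C1 C2 where C: "C1 > 0" "C2 > 0"
    "\<And>x v. C1 * tangent_norm g x v \<le> tangent_norm g' x v"
    "\<And>x v. tangent_norm g' x v \<le> C2 * tangent_norm g x v"
    using assms unfolding quasi_isometric_def by blast
  show ?thesis
    unfolding quasi_isometric_def
    using C by (intro exI[of _ "1 / C2"] exI[of _ "1 / C1"]) (simp add: field_simps)
qed

theorem corollary2p13:
  fixes A :: "('m::{t2_space, second_countable_topology}, 'n::finite) chart set"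
    and g g' :: "('m, 'n) metric"
  assumes "smooth_atlas A"
    and "connected (UNIV :: 'm set)"
    and "riemannian_metric A g"
    and "geodesically_complete A g"
    and "riemannian_metric A g'"
    and "quasi_isometric g g'"
  shows "BV_norms_equivalent A g g'"
proof -
  interpret smooth_manifold A by unfold_locales (rule assms(1))
  obtain C where C: "C > 0" "\<forall>f\<in>BV A g. f \<in> BV A g' \<and> BV_norm A g' f \<le> ennreal C * BV_norm A g f"
    using BV_norm_le[OF assms(3,5,6)] by blast
  \<comment> \<open>The same estimate with the metrics exchanged supplies both the converse
    inclusion and the reverse inequality.\<close>
  obtain D where D: "D > 0" "\<forall>f\<in>BV A g'. f \<in> BV A g \<and> BV_norm A g f \<le> ennreal D * BV_norm A g' f"
    using BV_norm_le[OF assms(5,3) quasi_isometric_sym[OF assms(6)]] by blast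
  have "BV A g = BV A g'" using C(2) D(2) by blast
  then show ?thesis
    unfolding BV_norms_equivalent_def using C D by blast
qed

end
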